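(* Let $(S,N,Z)$ be a structured semigroup such that $Z$ is symmetric. Then the map $\mathcal{C}:a\mapsto\mathcal{C}_a=\{C\in\mathcal{C}(S):a\in C\}$ is a universal étale representation of $(S,N,Z)$ (on the étale groupoid $\mathcal{C}(S)$).
   Context: A structured semigroup $(S,N,Z)$ consists of a semigroup $S$, a subsemigroup $N$ of $S$ and a subsemigroup $Z$ of $S$ with $Z\subseteq\mathsf{Z}(N)=\{z\in N:\forall n\in N\ (nz=zn)\}$, such that: (i) for all $a,b\in S$, $ab,ba\in Z$ implies $aZb\cup bZa\subseteq Z$; (ii) for all $a,b\in S$ and $n\in N$, if $abn=n=nab$ and $ab,ba\in Z$ then $bna\in N$. $Z$ is symmetric if for all $a,b\in S$, $ab\in Z$ implies $baba\in Z$. For $a,s,b\in S$: $a<_sb$ means $asb=a=bsa$, $as,sa\in N$ and $bs,sb\in Z$; $a<b$ means $a<_sb$ for some $s\in S$. For $A,B\subseteq S$: $AB=\{ab:a\in A,b\in B\}$, $A^<=\{b\in S:\exists a\in A\ (a<b)\}$ and $A^*=\{s\in S:\exists a\in A\,\exists b\in S\ (a<_sb)\}$. A coset is a $C\subseteq S$ with $CC^*C\subseteq C=C^<$. $\mathcal{C}(S)$ is the set of non-empty cosets; with $\mathsf{s}(C)=(C^*C)^<$ and $\mathsf{r}(C)=(CC^* )^<$, it is an étale groupoid with inverse $C\mapsto C^*$, product $B\cdot C=(BC)^<$ defined when $\mathsf{s}(B)=\mathsf{r}(C)$, and the topology with subbasis $(\mathcal{C}_a)_{a\in S}$. Groupoids: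 $G^0$ is the set of units of $G$, $\mathsf{s}(g)=g^{-1}g$, $\mathsf{r}(g)=gg^{-1}$, $gh$ is defined iff $\mathsf{s}(g)=\mathsf{r}(h)$. A slice is a subset on which $\mathsf{s}$ and $\mathsf{r}$ are injective. A topological groupoid (continuous inverse and product) is étale if $\mathsf{s}$ maps open subsets of $G$ to open subsets of $G$; no Hausdorff assumptions. $\mathcal{O}(X)$ denotes the open subsets of $X$ and $\mathcal{B}(G)$ the semigroup of open slices of $G$ under $AB=\{ab:a\in A,b\in B,\ ab\text{ defined}\}$. An étale representation of $(S,N,Z)$ on an étale groupoid $G$ is a semigroup homomorphism $\theta:S\to\mathcal{B}(G)$ such that $\bigcup_{a\in S}\theta(a)=G$, $\theta[N]\subseteq\mathcal{O}(G^0)$ and, for all $g\in G$ and $a\in S$, $g\in\theta(a)$ implies $g\in\theta(b)$ for some $b<a$. An étale morphism $\phi:H\to G$ between étale groupoids is a continuous functor that is star-bijective, i.e. for each $h\in H^0$ and each $g\in G$ with $\mathsf{r}(g)=\phi(h)$ there is precisely one $i\in H$ with $\mathsf{r}(i)=h$ and $\phi(i)=g$. It induces $\overline\phi:\mathcal{B}(G)\to\mathcal{B}(H)$, $\overline\phi(O)=\phi^{-1}[O]$. An étale representation $\mu:S\to\mathcal{B}(G)$ is universal if for every étale representation $\theta:S\to\mathcal{B}(H)$ (on any étale groupoid $H$) there is a unique étale morphism $\phi:H\to G$ with $\theta=\overline\phi\circ\mu$. *)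

theory Defs
  imports "HOL-Analysis.Analysis"
begin

section \<open>Structured semigroups and their cosets\<close>

text \<open>
  The ambient semigroup \<open>S\<close> is the type \<^typ>\<open>'a::semigroup_mult\<close>. Products of subsets are the
  elementwise products of \<open>HOL-Library.Set_Algebras\<close>. Subsemigroups are allowed to be empty.
\<close>

definition semigroup_center :: "'a::semigroup_mult set \<Rightarrow> 'a set" where
  "semigroup_center N = {z \<in> N. \<forall>n\<in>N. n * z = z * n}"

locale structured_semigroup =
  fixes N Z :: "'a::semigroup_mult set"
  assumes N_mult_closed: "\<lbrakk>m \<in> N; n \<in> N\<rbrakk> \<Longrightarrow> m * n \<in> N"
    and Z_mult_closed: "\<lbrakk>y \<in> Z; z \<in> Z\<rbrakk> \<Longrightarrow> y * z \<in> Z"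
    and Z_central: "Z \<subseteq> semigroup_center N"
    and Z_conj: "\<lbrakk>a * b \<in> Z; b * a \<in> Z\<rbrakk> \<Longrightarrow> {a} * Z * {b} \<union> {b} * Z * {a} \<subseteq> Z"
    and N_conj: "\<lbrakk>n \<in> N; a * b * n = n; n = n * a * b; a * b \<in> Z; b * a \<in> Z\<rbrakk> \<Longrightarrow> b * n * a \<in> N"

definition symmetric_set :: "'a::semigroup_mult set \<Rightarrow> bool" where
  "symmetric_set Z \<longleftrightarrow> (\<forall>a b. a * b \<in> Z \<longrightarrow> b * a * b * a \<in> Z)"

text \<open>\<open>below_via N Z a s b\<close> is the relation \<open>a <\<^sub>s b\<close>.\<close>

definition below_via :: "'a::semigroup_mult set \<Rightarrow> 'a set \<Rightarrow> 'a \<Rightarrow> 'a \<Rightarrow> 'a \<Rightarrow> bool" where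
  "below_via N Z a s b \<longleftrightarrow>
     a * s * b = a \<and> a = b * s * a \<and> a * s \<in> N \<and> s * a \<in> N \<and> b * s \<in> Z \<and> s * b \<in> Z"

definition below :: "'a::semigroup_mult set \<Rightarrow> 'a set \<Rightarrow> 'a \<Rightarrow> 'a \<Rightarrow> bool" where
  "below N Z a b \<longleftrightarrow> (\<exists>s. below_via N Z a s b)"

definition up_closure :: "'a::semigroup_mult set \<Rightarrow> 'a set \<Rightarrow> 'a set \<Rightarrow> 'a set" where
  "up_closure N Z A = {b. \<exists>a\<in>A. below N Z a b}"

definition star :: "'a::semigroup_mult set \<Rightarrow> 'a set \<Rightarrow> 'a set \<Rightarrow> 'a set" where
  "star N Z A = {s. \<exists>a\<in>A. \<exists>b. below_via N Z a s b}"

definition is_coset :: "'a::semigroup_mult set \<Rightarrow> 'a set \<Rightarrow> 'a set \<Rightarrow> bool" where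
  "is_coset N Z C \<longleftrightarrow> C * star N Z C * C \<subseteq> C \<and> C = up_closure N Z C"

definition cosets :: "'a::semigroup_mult set \<Rightarrow> 'a set \<Rightarrow> 'a set set" where
  "cosets N Z = {C. is_coset N Z C \<and> C \<noteq> {}}"

text \<open>The map \<open>a \<mapsto> \<C>\<^sub>a\<close>.\<close>

definition coset_map :: "'a::semigroup_mult set \<Rightarrow> 'a set \<Rightarrow> 'a \<Rightarrow> 'a set set" where
  "coset_map N Z a = {C \<in> cosets N Z. a \<in> C}"


section \<open>Etale groupoids\<close>

text \<open>
  The product of a groupoid is a total HOL function of which only the values on composable pairs
  of arrows are meaningful.
\<close>

record 'g groupoid =
  arrows :: "'g set"
  gmult :: "'g \<Rightarrow> 'g \<Rightarrow> 'g"
  ginv :: "'g \<Rightarrow> 'g"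

record 'g topological_groupoid = "'g groupoid" +
  gtop :: "'g topology"

definition src :: "('g, 'z) groupoid_scheme \<Rightarrow> 'g \<Rightarrow> 'g" where
  "src G g = gmult G (ginv G g) g"

definition rng :: "('g, 'z) groupoid_scheme \<Rightarrow> 'g \<Rightarrow> 'g" where
  "rng G g = gmult G g (ginv G g)"

definition composable :: "('g, 'z) groupoid_scheme \<Rightarrow> ('g \<times> 'g) set" where
  "composable G = {(g, h). g \<in> arrows G \<and> h \<in> arrows G \<and> src G g = rng G h}"

definition gunits :: "('g, 'z) groupoid_scheme \<Rightarrow> 'g set" where
  "gunits G = src G ` arrows G"

text \<open>
  These are the axioms of a small category in which every arrow is invertible, with objects
  identified with their identity arrows. That \<open>(ginv G g, g)\<close> and \<open>(g, ginv G g)\<close> are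
  composable follows from \<open>ginv_ginv\<close>.
\<close>

locale groupoid =
  fixes G :: "('g, 'z) groupoid_scheme"
  assumes ginv_closed: "g \<in> arrows G \<Longrightarrow> ginv G g \<in> arrows G"
    and ginv_ginv: "g \<in> arrows G \<Longrightarrow> ginv G (ginv G g) = g"
    and gmult_closed: "(g, h) \<in> composable G \<Longrightarrow> gmult G g h \<in> arrows G"
    and src_gmult: "(g, h) \<in> composable G \<Longrightarrow> src G (gmult G g h) = src G h"
    and rng_gmult: "(g, h) \<in> composable G \<Longrightarrow> rng G (gmult G g h) = rng G g"
    and gmult_assoc: "\<lbrakk>(g, h) \<in> composable G; (h, k) \<in> composable G\<rbrakk>
      \<Longrightarrow> gmult G (gmult G g h) k = gmult G g (gmult G h k)"
    and gmult_src: "g \<in> arrows G \<Longrightarrow> gmult G g (src G g) = g"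
    and rng_gmult_left: "g \<in> arrows G \<Longrightarrow> gmult G (rng G g) g = g"

locale topological_groupoid = groupoid G for G :: "('g, 'z) topological_groupoid_scheme" +
  assumes topspace_gtop: "topspace (gtop G) = arrows G"
    and continuous_ginv: "continuous_map (gtop G) (gtop G) (ginv G)"
    and continuous_gmult:
      "continuous_map (subtopology (prod_topology (gtop G) (gtop G)) (composable G)) (gtop G)
         (\<lambda>(g, h). gmult G g h)"

locale etale_groupoid = topological_groupoid G for G :: "('g, 'z) topological_groupoid_scheme" +
  assumes open_map_src: "open_map (gtop G) (gtop G) (src G)"

definition is_slice :: "('g, 'z) groupoid_scheme \<Rightarrow> 'g set \<Rightarrow> bool" where
  "is_slice G A \<longleftrightarrow> A \<subseteq> arrows G \<and> inj_on (src G) A \<and> inj_on (rng G) A"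

definition open_slices :: "('g, 'z) topological_groupoid_scheme \<Rightarrow> 'g set set" where
  "open_slices G = {A. openin (gtop G) A \<and> is_slice G A}"

definition slice_mult :: "('g, 'z) groupoid_scheme \<Rightarrow> 'g set \<Rightarrow> 'g set \<Rightarrow> 'g set" where
  "slice_mult G A B = {gmult G a b | a b. a \<in> A \<and> b \<in> B \<and> (a, b) \<in> composable G}"


section \<open>The coset groupoid\<close>

definition coset_groupoid ::
    "'a::semigroup_mult set \<Rightarrow> 'a set \<Rightarrow> 'a set topological_groupoid" where
  "coset_groupoid N Z =
     \<lparr>arrows = cosets N Z,
      gmult = (\<lambda>B C. up_closure N Z (B * C)),
      ginv = star N Z,
      gtop = topology_generated_by (range (coset_map N Z))\<rparr>"


section \<open>Etale representations and morphisms\<close>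

definition etale_representation ::
    "'a::semigroup_mult set \<Rightarrow> 'a set \<Rightarrow> ('g, 'z) topological_groupoid_scheme
      \<Rightarrow> ('a \<Rightarrow> 'g set) \<Rightarrow> bool" where
  "etale_representation N Z G \<theta> \<longleftrightarrow>
     etale_groupoid G \<and>
     (\<forall>a. \<theta> a \<in> open_slices G) \<and>
     (\<forall>a b. \<theta> (a * b) = slice_mult G (\<theta> a) (\<theta> b)) \<and>
     (\<Union>a. \<theta> a) = arrows G \<and>
     (\<forall>n\<in>N. openin (subtopology (gtop G) (gunits G)) (\<theta> n)) \<and>
     (\<forall>g\<in>arrows G. \<forall>a. g \<in> \<theta> a \<longrightarrow> (\<exists>b. below N Z b a \<and> g \<in> \<theta> b))"

definition groupoid_functor ::
    "('h, 'y) groupoid_scheme \<Rightarrow> ('g, 'z) groupoid_scheme \<Rightarrow> ('h \<Rightarrow> 'g) \<Rightarrow> bool" where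
  "groupoid_functor H G \<phi> \<longleftrightarrow>
     (\<forall>h\<in>arrows H. \<phi> h \<in> arrows G \<and> \<phi> (src H h) = src G (\<phi> h) \<and> \<phi> (rng H h) = rng G (\<phi> h)) \<and>
     (\<forall>(h, i)\<in>composable H. \<phi> (gmult H h i) = gmult G (\<phi> h) (\<phi> i))"

definition star_bijective ::
    "('h, 'y) groupoid_scheme \<Rightarrow> ('g, 'z) groupoid_scheme \<Rightarrow> ('h \<Rightarrow> 'g) \<Rightarrow> bool" where
  "star_bijective H G \<phi> \<longleftrightarrow>
     (\<forall>h\<in>gunits H. \<forall>g\<in>arrows G. rng G g = \<phi> h \<longrightarrow> (\<exists>!i. i \<in> arrows H \<and> rng H i = h \<and> \<phi> i = g))"

definition etale_morphism ::
    "('h, 'y) topological_groupoid_scheme \<Rightarrow> ('g, 'z) topological_groupoid_scheme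
      \<Rightarrow> ('h \<Rightarrow> 'g) \<Rightarrow> bool" where
  "etale_morphism H G \<phi> \<longleftrightarrow>
     etale_groupoid H \<and> etale_groupoid G \<and>
     continuous_map (gtop H) (gtop G) \<phi> \<and> groupoid_functor H G \<phi> \<and> star_bijective H G \<phi>"

text \<open>The map \<open>O \<mapsto> \<phi>\<^sup>-\<^sup>1[O]\<close> induced by \<open>\<phi>\<close> on open slices.\<close>

definition pullback :: "('h, 'y) groupoid_scheme \<Rightarrow> ('h \<Rightarrow> 'g) \<Rightarrow> 'g set \<Rightarrow> 'h set" where
  "pullback H \<phi> U = {h \<in> arrows H. \<phi> h \<in> U}"

text \<open>
  HOL cannot quantify over types inside a formula, so the type of arrows of the test groupoids
  \<open>H\<close> is an explicit argument; a theorem that leaves it a type variable covers all groupoids.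
  Morphisms are functions on the arrows of \<open>H\<close>, so uniqueness is equality there.
\<close>

definition universal_etale_representation ::
    "'h itself \<Rightarrow> 'a::semigroup_mult set \<Rightarrow> 'a set \<Rightarrow> ('g, 'z) topological_groupoid_scheme
      \<Rightarrow> ('a \<Rightarrow> 'g set) \<Rightarrow> bool" where
  "universal_etale_representation TYPE('h) N Z G \<mu> \<longleftrightarrow>
     etale_representation N Z G \<mu> \<and>
     (\<forall>(H :: 'h topological_groupoid) \<theta>. etale_representation N Z H \<theta> \<longrightarrow>
        (\<exists>\<phi>. etale_morphism H G \<phi> \<and> \<theta> = pullback H \<phi> \<circ> \<mu> \<and>
          (\<forall>\<psi>. etale_morphism H G \<psi> \<and> \<theta> = pullback H \<psi> \<circ> \<mu> \<longrightarrow> (\<forall>h\<in>arrows H. \<psi> h = \<phi> h))))"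

end

theory Submission
  imports Defs
begin

text \<open>
  Read \<open>S\<close> as a semigroup of slices of a groupoid, with \<open>N\<close> consisting of slices of units and \<open>Z\<close> of
  slices of units that commute with them. Then \<open>a \<sqsubset>[s] b\<close> says that \<open>s\<close> inverts \<open>b\<close>
  around \<open>a\<close>: the elements \<open>b * s\<close> and \<open>s * b\<close> of \<open>Z\<close> act as identities on \<open>a\<close>. In a representation
  \<open>\<theta>\<close> an arrow \<open>h\<close> is therefore recorded by its set of labels \<open>{a. h \<in> \<theta> a}\<close>. This set is
  a coset, because \<open>a \<sqsubset>[s] b\<close> and \<open>h \<in> \<theta> a\<close> force \<open>h \<in> \<theta> b\<close> and put the inverse
  of \<open>h\<close> into \<open>\<theta> s\<close> (\<open>rep_below_via\<close>). A morphism \<open>\<phi>\<close> that induces \<open>\<theta>\<close> from the map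
  \<open>a \<mapsto> \<C>\<^sub>a\<close> has no choice but to send \<open>h\<close> to its labels, so uniqueness is immediate. Existence means
  that labelling is a continuous functor and star-bijective. Lifting a coset \<open>C\<close> along a unit \<open>h\<close>
  is done by picking \<open>a \<in> C\<close> and the only arrow of \<open>\<theta> a\<close> with range \<open>h\<close>; this arrow has the
  label set \<open>C\<close> because a coset is determined by one of its elements and its range
  (\<open>coset_eqI_range\<close>).

  The remaining work is to show that the cosets form an etale groupoid represented by
  \<open>a \<mapsto> \<C>\<^sub>a\<close>. Elements of \<open>N\<close> need not have inverses in \<open>N\<close>, not even local ones, so each step has to find an
  explicit element of \<open>S\<close> that plays the role of such an inverse. The statements that carry the argument are:

  \<^item> \<open>below_second_inverse\<close>: an inverse of an inverse of an element of a coset lies in the coset, so that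
    \<open>C \<mapsto> C\<^sup>\<star>\<close> is an involution on cosets;

  \<^item> \<open>inverse_factorises\<close>: for composable cosets \<open>B\<close> and \<open>C\<close>, an inverse of a product \<open>b * c\<close> is above
    a product of inverses, so that \<open>(B * C)\<^sup>\<star>\<close> generates the same up-set as \<open>C\<^sup>\<star> * B\<^sup>\<star>\<close>
    and \<open>up (B * C)\<close> is a coset (\<open>mult_coset\<close>);

  \<^item> \<open>translate\<close>: an element \<open>a\<close> that is invertible over some element of a unit coset \<open>U\<close> moves \<open>U\<close> to a
    coset \<open>up ({a} * U)\<close> with source \<open>U\<close> that contains \<open>a\<close>. This is how cosets are obtained from elements: it shows
    that the source map is open, and that a coset containing \<open>a * b\<close> is a product of cosets containing
    \<open>a\<close> and \<open>b\<close> (\<open>mult_factor\<close>). Symmetry of \<open>Z\<close> enters in the latter, to find a local inverse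
    of \<open>a\<close> from one of \<open>a * b\<close>.

  The lemma used most often is that elements of \<open>N\<close> preserve \<open>\<sqsubset>[v]\<close> from below on either side
  (\<open>N_mult_below_via\<close>): multiplying \<open>y\<close> by a slice of units can only shrink it.
\<close>

section \<open>Domination\<close>

context structured_semigroup
begin

abbreviation below_via_NZ ("(_ \<sqsubset>[_] _)" [51, 0, 51] 50) where
  "a \<sqsubset>[s] b \<equiv> below_via N Z a s b"

abbreviation below_NZ (infix "\<sqsubset>" 50) where
  "a \<sqsubset> b \<equiv> below N Z a b"

abbreviation up where
  "up \<equiv> up_closure N Z"

abbreviation star_NZ ("_\<^sup>\<star>" [1000] 1000) where
  "A\<^sup>\<star> \<equiv> star N Z A"

lemma Z_in_N: "z \<in> Z \<Longrightarrow> z \<in> N"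
  using Z_central by (auto simp: semigroup_center_def)

lemma Z_commute: "z \<in> Z \<Longrightarrow> n \<in> N \<Longrightarrow> z * n = n * z"
  using Z_central by (auto simp: semigroup_center_def)

lemma Z_conjugate:
  assumes "a * b \<in> Z" "b * a \<in> Z" "z \<in> Z"
  shows "a * z * b \<in> Z"
  using Z_conj[OF assms(1,2)] assms(3) by blast

lemma below_viaI:
  assumes "a * s * b = a" "b * s * a = a" "a * s \<in> N" "s * a \<in> N" "b * s \<in> Z" "s * b \<in> Z"
  shows "a \<sqsubset>[s] b"
  using assms by (simp add: below_via_def)

lemma below_viaD:
  assumes "a \<sqsubset>[s] b"
  shows "a * s * b = a" "b * s * a = a" "a * s \<in> N" "s * a \<in> N" "b * s \<in> Z" "s * b \<in> Z"
  using assms by (simp_all add: below_via_def)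

text \<open>
  With products bracketed to the right, a rewriting step inside a longer word needs the version of each
  equation that has a trailing factor.
\<close>

lemma below_viaD_word:
  assumes "a \<sqsubset>[s] b"
  shows "a * (s * b) = a" "b * (s * a) = a" "a * (s * (b * x)) = a * x" "b * (s * (a * x)) = a * x"
  using assms unfolding below_via_def by (metis mult.assoc)+

lemma below_via_below: "a \<sqsubset>[s] b \<Longrightarrow> a \<sqsubset> b"
  by (auto simp: below_def)

text \<open>
  The inverse \<open>t\<close> of the larger element \<open>c\<close> inverts \<open>b\<close> too, hence also \<open>a\<close>: on \<open>a\<close> the factor
  \<open>s * b\<close> can be inserted, and \<open>a * t = (a * s) * (b * t)\<close> is a product of elements of \<open>N\<close>.
\<close>

lemma below_via_trans:
  assumes "a \<sqsubset>[s] b" "b \<sqsubset>[t] c"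
  shows "a \<sqsubset>[t] c"
proof (rule below_viaI)
  note w = below_viaD_word[OF assms(1)] below_viaD_word[OF assms(2)]
  note d = below_viaD[OF assms(1)] below_viaD[OF assms(2)]
  show "a * t * c = a" "c * t * a = a"
    using w by (metis mult.assoc)+
  have "a * t = (a * s) * (b * t)" "t * a = (t * b) * (s * a)"
    using w by (metis mult.assoc)+
  then show "a * t \<in> N" "t * a \<in> N"
    using d N_mult_closed by metis+
qed (use below_viaD[OF assms(2)] in auto)

lemma below_trans: "a \<sqsubset> b \<Longrightarrow> b \<sqsubset> c \<Longrightarrow> a \<sqsubset> c"
  using below_via_trans unfolding below_def by blast

text \<open>
  In \<open>a * c * (t * s) * (b * d)\<close> the factor \<open>c * t\<close> of \<open>N\<close> commutes with the factor
  \<open>s * b\<close> of \<open>Z\<close>, after which both inverses cancel. Membership of \<open>a * c * (t * s)\<close> in \<open>N\<close>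
  comes from conjugating \<open>s * a * (c * t)\<close> by \<open>b\<close> and \<open>s\<close>, on which \<open>s * b\<close> acts as an identity.
\<close>

lemma below_via_mult:
  assumes "a \<sqsubset>[s] b" "c \<sqsubset>[t] d"
  shows "a * c \<sqsubset>[t * s] b * d"
proof (rule below_viaI)
  note w = below_viaD_word[OF assms(1)] below_viaD_word[OF assms(2)]
  note d = below_viaD[OF assms(1)] below_viaD[OF assms(2)]
  have c1: "(c * t) * (s * b) = (s * b) * (c * t)"
    and c2: "(s * a) * (d * t) = (d * t) * (s * a)"
    using d Z_commute by metis+
  have "a * c * (t * s) * (b * d) = a * ((c * t) * (s * b)) * d"
    by (simp only: mult.assoc)
  also have "\<dots> = (a * s * b) * (c * t * d)"
    unfolding c1 by (simp only: mult.assoc)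
  finally show "a * c * (t * s) * (b * d) = a * c"
    using d by simp
  have "b * d * (t * s) * (a * c) = b * ((d * t) * (s * a)) * c"
    by (simp only: mult.assoc)
  also have "\<dots> = (b * s * a) * (d * t * c)"
    unfolding c2[symmetric] by (simp only: mult.assoc)
  finally show "b * d * (t * s) * (a * c) = a * c"
    using d by simp
  let ?n = "s * a * (c * t)"
  have n: "?n \<in> N" using d N_mult_closed by blast
  have n1: "s * b * ?n = ?n" using w by (simp add: mult.assoc)
  have n2: "?n * s * b = ?n"
  proof -
    have "?n * s * b = s * a * ((c * t) * (s * b))" by (simp only: mult.assoc)
    also have "\<dots> = s * (a * s * b) * (c * t)" unfolding c1 by (simp only: mult.assoc)
    finally show ?thesis using d by simp
  qed
  have n3: "d * t * ?n = ?n"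
  proof -
    have "d * t * ?n = ((d * t) * (s * a)) * (c * t)" by (simp only: mult.assoc)
    also have "\<dots> = s * a * (d * t * c) * t" unfolding c2[symmetric] by (simp only: mult.assoc)
    finally show ?thesis using w by (simp add: mult.assoc)
  qed
  have n4: "?n * d * t = ?n" using w by (simp add: mult.assoc)
  have "b * ?n * s \<in> N"
    using N_conj[OF n, of s b] n1 n2 d by auto
  then show "a * c * (t * s) \<in> N"
    using w by (simp add: mult.assoc)
  have "t * ?n * d \<in> N"
    using N_conj[OF n, of d t] n3 n4 d by auto
  then show "t * s * (a * c) \<in> N"
    using w by (simp add: mult.assoc)
  have "b * (d * t) * s \<in> Z" "t * (s * b) * d \<in> Z"
    using d Z_conjugate by blast+
  then show "b * d * (t * s) \<in> Z" "t * s * (b * d) \<in> Z"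
    by (simp_all add: mult.assoc)
qed

lemma below_mult: "a \<sqsubset> b \<Longrightarrow> c \<sqsubset> d \<Longrightarrow> a * c \<sqsubset> b * d"
  using below_via_mult unfolding below_def by blast

text \<open>
  The restriction \<open>s * a * s\<close> of \<open>s\<close> is the inverse of \<open>a\<close>, and \<open>b\<close> inverts \<open>s\<close> around it.
\<close>

lemma below_via_dual:
  assumes "a \<sqsubset>[s] b"
  shows "s * a * s \<sqsubset>[b] s"
  using below_viaD[OF assms] below_viaD_word[OF assms]
  by (intro below_viaI) (auto simp: mult.assoc)

text \<open>
  Since \<open>x * v\<close> is in \<open>Z\<close> it commutes with \<open>n\<close>, and it fixes \<open>y\<close>, so it fixes \<open>n * y\<close>. The
  product \<open>v * (n * y)\<close> is the conjugate of \<open>n * y * v\<close> by \<open>v\<close> and \<open>x\<close>.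
\<close>

lemma N_mult_below_via:
  assumes "n \<in> N" "y \<sqsubset>[v] x"
  shows "n * y \<sqsubset>[v] x"
proof (rule below_viaI)
  note w = below_viaD_word[OF assms(2)] and d = below_viaD[OF assms(2)]
  show "n * y * v * x = n * y" using w by (simp add: mult.assoc)
  have c: "x * v * n = n * (x * v)" using d assms Z_commute by metis
  have "x * v * (n * y) = (x * v * n) * y" by (simp only: mult.assoc)
  then show "x * v * (n * y) = n * y"
    unfolding c using w by (simp add: mult.assoc)
  show nyv: "n * y * v \<in> N" using d assms N_mult_closed by (simp add: mult.assoc)
  have "x * v * (n * y * v) = (x * v * n) * (y * v)" by (simp only: mult.assoc)
  then have "x * v * (n * y * v) = n * y * v" unfolding c using w by (simp add: mult.assoc)
  moreover have "n * y * v = n * y * v * x * v" using w by (simp add: mult.assoc)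
  ultimately have "v * (n * y * v) * x \<in> N" using N_conj[OF nyv] d by metis
  then show "v * (n * y) \<in> N" using w by (simp add: mult.assoc)
qed (use below_viaD[OF assms(2)] in auto)

lemma below_via_mult_N:
  assumes "n \<in> N" "y \<sqsubset>[v] x"
  shows "y * n \<sqsubset>[v] x"
proof (rule below_viaI)
  note w = below_viaD_word[OF assms(2)] and d = below_viaD[OF assms(2)]
  show "x * v * (y * n) = y * n" using w by (simp add: mult.assoc)
  have c: "n * (v * x) = v * x * n" using d assms Z_commute by metis
  have "y * n * v * x = y * (n * (v * x))" by (simp only: mult.assoc)
  then show "y * n * v * x = y * n"
    unfolding c using w by (simp add: mult.assoc)
  show vyn: "v * (y * n) \<in> N" using d assms N_mult_closed by (simp add: mult.assoc[symmetric])
  have "v * (y * n) * v * x = v * y * (n * (v * x))" by (simp only: mult.assoc)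
  then have "v * (y * n) = v * (y * n) * v * x" unfolding c using w by (simp add: mult.assoc)
  moreover have "v * x * (v * (y * n)) = v * (y * n)" using w by (simp add: mult.assoc)
  ultimately have "x * (v * (y * n)) * v \<in> N" using N_conj[OF vyn] d by metis
  then show "y * n * v \<in> N" using w by (simp add: mult.assoc)
qed (use below_viaD[OF assms(2)] in auto)

text \<open>
  Multiplying \<open>s\<close> by the element \<open>b * r\<close> of \<open>N\<close> restricts \<open>s\<close> to the place where \<open>b\<close> lives, provided that \<open>y * s\<close>
  is an identity there.
\<close>

lemma below_via_conjugate:
  assumes Z: "y * s \<in> Z" "s * y \<in> Z" and n: "b * r \<in> N" and fixed: "y * s * b = b"
  shows "s * b * r \<sqsubset>[y] s"
proof -
  let ?n = "b * r"
  have n1: "y * s * ?n = ?n" using fixed by (simp add: mult.assoc[symmetric])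
  then have n2: "?n * (y * s) = ?n" using Z_commute[of "y * s" ?n] n Z by simp
  show ?thesis
  proof (rule below_viaI)
    show "s * b * r * y * s = s * b * r" using n2 by (simp add: mult.assoc)
    show "s * y * (s * b * r) = s * b * r" using n1 by (simp add: mult.assoc)
    show "y * (s * b * r) \<in> N" using n n1 by (simp add: mult.assoc)
    have "?n = ?n * y * s" using n2 by (simp only: mult.assoc)
    from N_conj[OF n n1 this Z] have "s * ?n * y \<in> N" .
    then show "s * b * r * y \<in> N" by (simp add: mult.assoc)
  qed (use Z in auto)
qed

text \<open>
  The restricted inverse \<open>s * a * s\<close> still inverts over the smaller element \<open>e\<close>. It does not invert
  \<open>b\<close> itself, as \<open>a * s\<close> is only in \<open>N\<close>; replacing \<open>b\<close> by \<open>b * t * b\<close> turns this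
  factor into the element \<open>a * t\<close> of \<open>Z\<close>.
\<close>

lemma below_via_shrink:
  assumes "e \<sqsubset>[t] a" "a \<sqsubset>[s] b"
  shows "e \<sqsubset>[s * a * s] b * t * b"
proof (rule below_viaI)
  note es = below_via_trans[OF assms]
  note w = below_viaD_word[OF assms(1)] below_viaD_word[OF assms(2)] below_viaD_word[OF es]
  note d = below_viaD[OF assms(1)] below_viaD[OF assms(2)] below_viaD[OF es]
  have c1: "e * s * (a * t) = (a * t) * (e * s)" and c2: "(t * a) * (s * e) = s * e * (t * a)"
    using d Z_commute by metis+
  have "e * (s * a * s) * (b * t * b) = e * s * (a * t) * b"
    using w by (simp add: mult.assoc)
  then show "e * (s * a * s) * (b * t * b) = e"
    unfolding c1 using w by (simp add: mult.assoc)
  have "b * t * b * (s * a * s) * e = b * ((t * a) * (s * e))"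
    using w by (simp add: mult.assoc)
  then show "b * t * b * (s * a * s) * e = e"
    unfolding c2 using w by (simp add: mult.assoc)
  have "(e * s) * (a * s) \<in> N" "(s * a) * (s * e) \<in> N"
    using d N_mult_closed by blast+
  then show "e * (s * a * s) \<in> N" "s * a * s * e \<in> N"
    by (simp_all add: mult.assoc)
  have "b * (t * a) * s \<in> Z" "s * (a * t) * b \<in> Z"
    using d Z_conjugate by blast+
  then show "b * t * b * (s * a * s) \<in> Z" "s * a * s * (b * t * b) \<in> Z"
    using w by (simp_all add: mult.assoc)
qed

text \<open>
  The element \<open>s * u\<close> of \<open>N\<close> measures how far \<open>u\<close> is from being equal to \<open>b\<close>, and
  \<open>r * b\<close> inverts it around \<open>s\<close>. So \<open>b * r * b\<close> is \<open>b\<close> corrected by the inverse of this element of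
  \<open>N\<close>, although \<open>N\<close> itself need not contain inverses, and its own inverse is \<open>s * u * s\<close>.
\<close>

lemma below_via_invert:
  assumes "a \<sqsubset>[s] b" "s \<sqsubset>[u] r"
  shows "a \<sqsubset>[s * u * s] b * r * b"
proof (rule below_viaI)
  note w = below_viaD_word[OF assms(1)] below_viaD_word[OF assms(2)]
  note d = below_viaD[OF assms(1)] below_viaD[OF assms(2)]
  \<comment> \<open>\<open>z\<close> is the product of \<open>r * b\<close> and \<open>s * u\<close>; it acts as the identity on \<open>s * a\<close>.\<close>
  define z where "z = r * (b * s) * u"
  have z: "z \<in> Z" unfolding z_def using d Z_conjugate by blast
  have c: "b * s * (u * s) = u * s * (b * s)" using d Z_commute by metis
  have "z * (s * a) = r * (b * s * (u * s)) * a" unfolding z_def by (simp only: mult.assoc)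
  then have zsa: "z * (s * a) = s * a" unfolding c using w by (simp add: mult.assoc)
  have "(s * b) * (s * u) = (s * u) * (s * b)" using d Z_commute by metis
  then have "s * u * s * (b * r * b) = s * b * (s * u) * r * b" by (simp add: mult.assoc)
  then have sb: "s * u * s * (b * r * b) = s * b * (s * b)" using w by (simp add: mult.assoc)
  then show "s * u * s * (b * r * b) \<in> Z" using d Z_mult_closed by simp
  have "a * (s * u * s) * (b * r * b) = a * (s * u * s * (b * r * b))" by (simp add: mult.assoc)
  then show "a * (s * u * s) * (b * r * b) = a"
    unfolding sb using w by (simp add: mult.assoc)
  have "b * z * s \<in> Z" using z d Z_conjugate by blast
  then show "b * r * b * (s * u * s) \<in> Z" unfolding z_def by (simp add: mult.assoc)
  have "b * r * b * (s * u * s) * a = b * (z * (s * a))" unfolding z_def by (simp add: mult.assoc)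
  then show "b * r * b * (s * u * s) * a = a" unfolding zsa using w by simp
  have "(a * s) * (u * s) \<in> N" "(s * u) * (s * a) \<in> N" using d N_mult_closed by blast+
  then show "a * (s * u * s) \<in> N" "s * u * s * a \<in> N" by (simp_all add: mult.assoc)
qed

text \<open>
  The correction \<open>s * u * s\<close> of the previous lemma can be used as an inverse in a coset containing \<open>a\<close>
  and \<open>b\<close>. Multiplying it back by \<open>a\<close> and \<open>b\<close> cancels \<open>s\<close> and leaves a restriction of \<open>u\<close>.
\<close>

lemma below_via_second_inverse:
  assumes "a \<sqsubset>[s] b" "s \<sqsubset>[u] r"
  shows "a * (s * u * s) * b \<sqsubset>[r] u"
proof -
  note w = below_viaD_word[OF assms(1)] below_viaD_word[OF assms(2)]
  note d = below_viaD[OF assms(1)] below_viaD[OF assms(2)]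
  have c: "u * r * (a * s) = a * s * (u * r)" using d Z_commute by metis
  have asur: "a * s * u * r = a * s" using w by (simp add: mult.assoc)
  have "a * s * u \<sqsubset>[r] u"
  proof (rule below_viaI)
    show "a * s * u * r * u = a * s * u" using w by (simp add: mult.assoc)
    have "u * r * (a * s * u) = u * r * (a * s) * u" by (simp only: mult.assoc)
    then show "u * r * (a * s * u) = a * s * u" unfolding c using w by (simp add: mult.assoc)
    show "a * s * u * r \<in> N" using asur d by simp
    have "u * r * (a * s) = a * s" "a * s = a * s * u * r" using c asur by (simp_all add: mult.assoc)
    then have "r * (a * s) * u \<in> N" using N_conj[of "a * s" u r] d by blast
    then show "r * (a * s * u) \<in> N" by (simp add: mult.assoc)
  qed (use d in auto)
  from below_via_mult_N[OF Z_in_N[OF d(6)] this]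
  show ?thesis by (simp add: mult.assoc)
qed

section \<open>Cosets and their inverses\<close>

lemma up_iff: "x \<in> up A \<longleftrightarrow> (\<exists>a\<in>A. a \<sqsubset> x)"
  by (simp add: up_closure_def)

lemma upI: "a \<in> A \<Longrightarrow> a \<sqsubset> x \<Longrightarrow> x \<in> up A"
  unfolding up_iff by (rule bexI)

lemma up_mult_iff: "x \<in> up (A * B) \<longleftrightarrow> (\<exists>a\<in>A. \<exists>b\<in>B. a * b \<sqsubset> x)"
  by (auto simp: up_closure_def set_times_def)

lemma up_mono: "A \<subseteq> B \<Longrightarrow> up A \<subseteq> up B"
  unfolding up_closure_def by blast

lemma up_subset_up: "A \<subseteq> up B \<Longrightarrow> up A \<subseteq> up B"
  by (meson below_trans subset_iff up_iff)

lemma up_up: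
  assumes "A \<subseteq> up A"
  shows "up (up A) = up A"
  using up_subset_up[of "up A" A] up_mono[OF assms] by blast

lemma star_iff: "s \<in> A\<^sup>\<star> \<longleftrightarrow> (\<exists>a\<in>A. \<exists>b. a \<sqsubset>[s] b)"
  by (simp add: star_def)

lemma starI: "a \<in> A \<Longrightarrow> a \<sqsubset>[s] b \<Longrightarrow> s \<in> A\<^sup>\<star>"
  by (auto simp: star_iff)

text \<open>
  A set with \<open>A \<subseteq> up A\<close> is called rounded in what follows. For such sets, passing to the up-closure does not
  create new inverses, since \<open>a \<sqsubset> x \<sqsubset>[s] y\<close> gives \<open>a \<sqsubset>[s] y\<close>.
\<close>

lemma star_up:
  assumes "A \<subseteq> up A"
  shows "(up A)\<^sup>\<star> = A\<^sup>\<star>"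
proof
  show "(up A)\<^sup>\<star> \<subseteq> A\<^sup>\<star>"
  proof
    fix s assume "s \<in> (up A)\<^sup>\<star>"
    then obtain x y a t where "x \<sqsubset>[s] y" "a \<in> A" "a \<sqsubset>[t] x"
      unfolding star_iff by (auto simp: up_iff below_def)
    then show "s \<in> A\<^sup>\<star>" using below_via_trans starI by blast
  qed
  show "A\<^sup>\<star> \<subseteq> (up A)\<^sup>\<star>" using assms unfolding star_def by blast
qed

lemma rounded_mult:
  assumes "A \<subseteq> up A" "B \<subseteq> up B"
  shows "A * B \<subseteq> up (A * B)"
proof
  fix x assume "x \<in> A * B"
  then obtain a b where x: "x = a * b" "a \<in> A" "b \<in> B" by (rule set_times_elim)
  then obtain a' b' where "a' \<in> A" "a' \<sqsubset> a" "b' \<in> B" "b' \<sqsubset> b"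
    using assms by (meson subsetD up_iff)
  then show "x \<in> up (A * B)"
    using x below_mult upI set_times_intro by metis
qed

lemma up_mult_up:
  assumes "A \<subseteq> up A" "B \<subseteq> up B"
  shows "up (up A * up B) = up (A * B)"
proof
  have "up A * up B \<subseteq> up (A * B)"
  proof
    fix x assume "x \<in> up A * up B"
    then obtain a b where "x = a * b" "a \<in> up A" "b \<in> up B" by (rule set_times_elim)
    then show "x \<in> up (A * B)"
      using below_mult upI set_times_intro unfolding up_iff by metis
  qed
  then show "up (up A * up B) \<subseteq> up (A * B)" by (rule up_subset_up)
  show "up (A * B) \<subseteq> up (up A * up B)"
    using assms by (intro up_mono set_times_mono2)
qed

lemma up_mult_up_left: "A \<subseteq> up A \<Longrightarrow> B = up B \<Longrightarrow> up (up A * B) = up (A * B)"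
  using up_mult_up[of A B] by simp

lemma up_mult_up_right: "A = up A \<Longrightarrow> B \<subseteq> up B \<Longrightarrow> up (A * up B) = up (A * B)"
  using up_mult_up[of A B] by simp

lemma star_shrink:
  assumes "C = up C" "a \<in> C" "a \<sqsubset>[s] b"
  shows "s * a * s \<in> C\<^sup>\<star>"
proof -
  have "a \<in> up C" using assms by simp
  then obtain e t where "e \<in> C" "e \<sqsubset>[t] a" by (auto simp: up_iff below_def)
  then show ?thesis using below_via_shrink[OF _ assms(3)] starI by blast
qed

lemma star_rounded:
  assumes "C = up C"
  shows "C\<^sup>\<star> \<subseteq> up (C\<^sup>\<star>)"
proof
  fix s assume "s \<in> C\<^sup>\<star>"
  then obtain a b where "a \<in> C" "a \<sqsubset>[s] b" by (auto simp: star_iff)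
  then show "s \<in> up (C\<^sup>\<star>)"
    using star_shrink[OF assms] below_via_dual below_via_below upI by metis
qed

lemma rounded_obtain:
  assumes "C \<subseteq> up C" "c \<in> C"
  obtains b s where "b \<in> C" "b \<sqsubset>[s] c" "s \<in> C\<^sup>\<star>"
  using assms starI unfolding subset_iff up_iff below_def by metis

lemma cosetD:
  assumes "C \<in> cosets N Z"
  shows coset_up: "up C = C" and coset_nonempty: "C \<noteq> {}"
    and coset_rounded: "C \<subseteq> up C"
    and coset_mult: "a \<in> C \<Longrightarrow> s \<in> C\<^sup>\<star> \<Longrightarrow> b \<in> C \<Longrightarrow> a * s * b \<in> C"
    and coset_mult_subset: "C * C\<^sup>\<star> * C \<subseteq> C"
  using assms unfolding cosets_def is_coset_def by blast+

lemma coset_upward: "C \<in> cosets N Z \<Longrightarrow> a \<in> C \<Longrightarrow> a \<sqsubset> b \<Longrightarrow> b \<in> C"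
  using coset_up upI by metis

lemma cosetI:
  assumes "C * C\<^sup>\<star> * C \<subseteq> C" "up C = C" "C \<noteq> {}"
  shows "C \<in> cosets N Z"
  using assms by (simp add: cosets_def is_coset_def)

text \<open>
  With \<open>a \<sqsubset>[s] b\<close> in \<open>C\<close>, the element \<open>s * u * s\<close> is again an inverse of an element of a
  coset, namely of \<open>a\<close> as an element below \<open>b * r * b\<close>. Hence \<open>a * (s * u * s) * b\<close> is in
  \<open>C * C\<^sup>\<star> * C\<close>, and it is below \<open>u\<close>.
\<close>

lemma below_second_inverse:
  assumes "C \<in> cosets N Z" "s \<in> C\<^sup>\<star>" "s \<sqsubset>[u] r"
  shows "\<exists>c\<in>C. c \<sqsubset>[r] u"
proof -
  obtain a b where a: "a \<in> C" "a \<sqsubset>[s] b" using assms(2) by (auto simp: star_iff)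
  then have "b \<in> C" using assms(1) below_via_below coset_upward by blast
  moreover have "s * u * s \<in> C\<^sup>\<star>" using a below_via_invert[OF _ assms(3)] starI by blast
  ultimately have "a * (s * u * s) * b \<in> C" using a coset_mult[OF assms(1)] by blast
  then show ?thesis using below_via_second_inverse[OF a(2) assms(3)] by blast
qed

lemma star_star_subset:
  assumes C: "C \<in> cosets N Z"
  shows "C\<^sup>\<star>\<^sup>\<star> \<subseteq> C"
proof
  fix u assume "u \<in> C\<^sup>\<star>\<^sup>\<star>"
  then obtain s r where "s \<in> C\<^sup>\<star>" "s \<sqsubset>[u] r" by (auto simp: star_iff[of u])
  then show "u \<in> C"
    using below_second_inverse[OF C] coset_upward[OF C] below_via_below by blast
qed

text \<open>
  Closure under \<open>C\<^sup>\<star> * C * C\<^sup>\<star>\<close>: an inverse for \<open>s * c * t\<close> is the product in reverse order of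
  inverses of the factors. For \<open>c\<close> this is \<open>u * c' * u\<close>, which is in \<open>C\<^sup>\<star>\<close>, so the whole product
  \<open>a' * (u * c' * u) * a\<close> is in \<open>C\<close>.
\<close>

lemma star_coset:
  assumes C: "C \<in> cosets N Z"
  shows "C\<^sup>\<star> \<in> cosets N Z"
proof (rule cosetI)
  note up = coset_up[OF C, symmetric]
  show "up (C\<^sup>\<star>) = C\<^sup>\<star>"
  proof
    show "up (C\<^sup>\<star>) \<subseteq> C\<^sup>\<star>"
    proof
      fix r assume "r \<in> up (C\<^sup>\<star>)"
      then obtain s u where "s \<in> C\<^sup>\<star>" "s \<sqsubset>[u] r" by (auto simp: up_iff below_def)
      then obtain c where "c \<in> C" "c \<sqsubset>[r] u" using below_second_inverse[OF C] by blast
      then show "r \<in> C\<^sup>\<star>" by (rule starI)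
    qed
  qed (use star_rounded[OF up] in blast)
  have ss: "C\<^sup>\<star>\<^sup>\<star> \<subseteq> C" using C by (rule star_star_subset)
  have "s * c * t \<in> C\<^sup>\<star>" if s: "s \<in> C\<^sup>\<star>" and c: "c \<in> C" and t: "t \<in> C\<^sup>\<star>" for s c t
  proof -
    obtain a b where a: "a \<in> C" "a \<sqsubset>[s] b" using s by (auto simp: star_iff)
    obtain a' b' where a': "a' \<in> C" "a' \<sqsubset>[t] b'" using t by (auto simp: star_iff)
    obtain c' u where c': "c' \<in> C" "c' \<sqsubset>[u] c" using rounded_obtain[OF coset_rounded[OF C] c] .
    have "u * c' * u \<in> C\<^sup>\<star>" using star_shrink[OF up c'] .
    then have "a' * (u * c' * u) * a \<in> C" using a a' coset_mult[OF C] by blast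
    moreover have "a' * (u * c' * u) * a \<sqsubset>[s * (c * t)] b' * u * b"
      by (intro below_via_mult a a' below_via_dual c')
    ultimately have "s * (c * t) \<in> C\<^sup>\<star>" by (rule starI)
    then show ?thesis by (simp add: mult.assoc)
  qed
  then have "C\<^sup>\<star> * C * C\<^sup>\<star> \<subseteq> C\<^sup>\<star>" by (blast elim: set_times_elim)
  then show "C\<^sup>\<star> * C\<^sup>\<star>\<^sup>\<star> * C\<^sup>\<star> \<subseteq> C\<^sup>\<star>"
    using ss by (meson order_trans set_times_mono2 subset_refl)
  show "C\<^sup>\<star> \<noteq> {}"
    using coset_nonempty[OF C] rounded_obtain[OF coset_rounded[OF C]] by blast
qed

lemma star_star:
  assumes C: "C \<in> cosets N Z"
  shows "C\<^sup>\<star>\<^sup>\<star> = C"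
proof
  show "C\<^sup>\<star>\<^sup>\<star> \<subseteq> C" using C by (rule star_star_subset)
  show "C \<subseteq> C\<^sup>\<star>\<^sup>\<star>"
  proof
    fix a assume "a \<in> C"
    then obtain e t where e: "e \<in> C" "e \<sqsubset>[t] a" using rounded_obtain[OF coset_rounded[OF C]] by metis
    then have "t * e * t \<in> C\<^sup>\<star>" using star_shrink[OF coset_up[OF C, symmetric]] by blast
    then show "a \<in> C\<^sup>\<star>\<^sup>\<star>" using below_via_dual[OF e(2)] starI by blast
  qed
qed

lemma up_mult_star_mult:
  assumes C: "C \<in> cosets N Z"
  shows "up (C * C\<^sup>\<star> * C) = C"
proof
  show "up (C * C\<^sup>\<star> * C) \<subseteq> C" using up_mono[OF coset_mult_subset[OF C]] coset_up[OF C] by simp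
  show "C \<subseteq> up (C * C\<^sup>\<star> * C)"
  proof
    fix a assume a: "a \<in> C"
    then obtain e t where e: "e \<in> C" "e \<sqsubset>[t] a" "t \<in> C\<^sup>\<star>"
      using rounded_obtain[OF coset_rounded[OF C]] by metis
    then have "e * t * a \<in> C * C\<^sup>\<star> * C" using a by (intro set_times_intro)
    then show "a \<in> up (C * C\<^sup>\<star> * C)"
      using e below_viaD(1)[OF e(2)] by (auto intro: upI below_via_below)
  qed
qed

section \<open>Sources, ranges and products of cosets\<close>

abbreviation "source C \<equiv> up (C\<^sup>\<star> * C)"
abbreviation "range_unit C \<equiv> up (C * C\<^sup>\<star>)"

lemma star_mult_rounded: "C \<in> cosets N Z \<Longrightarrow> C\<^sup>\<star> * C \<subseteq> up (C\<^sup>\<star> * C)"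
  by (intro rounded_mult coset_rounded star_coset)

lemma mult_star_rounded: "C \<in> cosets N Z \<Longrightarrow> C * C\<^sup>\<star> \<subseteq> up (C * C\<^sup>\<star>)"
  by (intro rounded_mult coset_rounded star_coset)

lemma source_star: "C \<in> cosets N Z \<Longrightarrow> source (C\<^sup>\<star>) = range_unit C"
  by (simp add: star_star)

lemma range_star: "C \<in> cosets N Z \<Longrightarrow> range_unit (C\<^sup>\<star>) = source C"
  by (simp add: star_star)

lemma coset_mult_source_up:
  assumes C: "C \<in> cosets N Z"
  shows "up (C * source C) = C"
  using up_mult_up_right[OF coset_up[OF C, symmetric] star_mult_rounded[OF C]] up_mult_star_mult[OF C]
  by (simp add: mult.assoc)

lemma range_mult_coset_up:
  assumes C: "C \<in> cosets N Z"
  shows "up (range_unit C * C) = C"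
  using up_mult_up_left[OF mult_star_rounded[OF C] coset_up[OF C, symmetric]] up_mult_star_mult[OF C]
  by simp

lemma coset_mult_source:
  assumes C: "C \<in> cosets N Z" and "c \<in> C" "u \<in> source C"
  shows "c * u \<in> C"
proof -
  have "C * source C \<subseteq> up (C * source C)"
    by (rule rounded_mult[OF coset_rounded[OF C] up_mono[OF star_mult_rounded[OF C]]])
  then show ?thesis
    using assms(2,3) coset_mult_source_up[OF C] by blast
qed

lemma range_mult_coset:
  assumes C: "C \<in> cosets N Z" and "u \<in> range_unit C" "c \<in> C"
  shows "u * c \<in> C"
proof -
  have "range_unit C * C \<subseteq> up (range_unit C * C)"
    by (rule rounded_mult[OF up_mono[OF mult_star_rounded[OF C]] coset_rounded[OF C]])
  then show ?thesis
    using assms(2,3) range_mult_coset_up[OF C] by blast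
qed

lemma star_mult_in_source: "C \<in> cosets N Z \<Longrightarrow> s \<in> C\<^sup>\<star> \<Longrightarrow> c \<in> C \<Longrightarrow> s * c \<in> source C"
  using star_mult_rounded by blast

lemma mult_star_in_range: "C \<in> cosets N Z \<Longrightarrow> c \<in> C \<Longrightarrow> s \<in> C\<^sup>\<star> \<Longrightarrow> c * s \<in> range_unit C"
  using mult_star_rounded by blast

text \<open>
  The naive candidate, an inverse of \<open>c\<close> times an inverse of \<open>b\<close>, is not below \<open>s\<close>, since \<open>s\<close> may
  differ from it by an element of \<open>N\<close> without inverse. The proof uses inverses of \<open>y * u\<close>
  instead of inverses of \<open>b\<close>, where \<open>u\<close> is an inverse from \<open>C\<^sup>\<star>\<close>: composability puts \<open>y * u\<close> into
  \<open>B\<close>, and if \<open>u\<close> is chosen so small that \<open>s * y\<close> is an identity on it, then an inverse \<open>r\<close> of \<open>y * u\<close>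
  over \<open>b0\<close> satisfies \<open>s * b0 * r = u * (r * b0 * r)\<close>, which is in \<open>C\<^sup>\<star> * B\<^sup>\<star>\<close>.
\<close>

lemma inverse_factorises:
  assumes B: "B \<in> cosets N Z" and C: "C \<in> cosets N Z" and BC: "source B = range_unit C"
    and b: "b \<in> B" and c: "c \<in> C" and via: "b * c \<sqsubset>[s] y"
  shows "s \<in> up (C\<^sup>\<star> * B\<^sup>\<star>)"
proof -
  note d = below_viaD[OF via] and w = below_viaD_word[OF via]
  note starC = star_coset[OF C]
  obtain b' t where b': "b' \<in> B" "b' \<sqsubset>[t] b" "t \<in> B\<^sup>\<star>"
    using rounded_obtain[OF coset_rounded[OF B] b] .
  have "t * b' \<in> range_unit C" using star_mult_in_source[OF B] b' BC by metis
  then have "t * b' * c \<in> C" using range_mult_coset[OF C] c by blast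
  \<comment> \<open>As \<open>s * y\<close> fixes \<open>b' * c\<close> from the right, it fixes every element below \<open>t * b' * c\<close>.\<close>
  then obtain c' v where c': "c' \<in> C" "c' \<sqsubset>[v] t * b' * c" "v \<in> C\<^sup>\<star>"
    by (rule rounded_obtain[OF coset_rounded[OF C]])
  note dc = below_viaD[OF c'(2)] and wc = below_viaD_word[OF c'(2)]
  define u where "u = v * c' * v"
  have u: "u \<in> C\<^sup>\<star>" using star_shrink[OF coset_up[OF C, symmetric] c'(1,2)] u_def by simp
  have b'bs: "b' * c * s * y = b' * c"
  proof -
    have e: "b' * t * (b * c) = b' * c"
      using below_viaD_word[OF b'(2)] by (simp add: mult.assoc)
    then have "b' * c * s * y = b' * t * (b * c * s * y)"
      by (metis mult.assoc)
    then show ?thesis using d(1) e by (simp add: mult.assoc)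
  qed
  have "c' * (s * y) = c' * v * (t * (b' * c * s * y))"
    using wc by (simp add: mult.assoc)
  then have c'sy: "c' * (s * y) = c'"
    unfolding b'bs using wc by (simp add: mult.assoc)
  have "s * y * u = (s * y) * (v * c') * v" by (simp add: u_def mult.assoc)
  also have "\<dots> = v * (c' * (s * y)) * v"
    using Z_commute[of "s * y" "v * c'"] d dc by (simp add: mult.assoc)
  finally have syu: "s * y * u = u" unfolding c'sy u_def by (simp add: mult.assoc)
  \<comment> \<open>By composability \<open>c * u'\<close> is in the source of \<open>B\<close>, and \<open>b * (c * u')\<close> is below \<open>y * u\<close>.\<close>
  have "y * u \<in> B"
  proof -
    obtain u' where u': "u' \<in> C\<^sup>\<star>" "u' \<sqsubset> u" using rounded_obtain[OF coset_rounded[OF starC] u] below_via_below by metis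
    have "c * u' \<in> source B" using mult_star_in_range[OF C c u'(1)] BC by simp
    then have "b * (c * u') \<in> B" using coset_mult_source[OF B b] by blast
    moreover have "b * (c * u') \<sqsubset> y * u"
      using below_mult[OF below_via_below[OF via] u'(2)] by (simp add: mult.assoc)
    ultimately show ?thesis using coset_upward[OF B] by blast
  qed
  then obtain b0 r where b0: "b0 \<in> B" "b0 \<sqsubset>[r] y * u" "r \<in> B\<^sup>\<star>"
    by (rule rounded_obtain[OF coset_rounded[OF B]])
  note d0 = below_viaD[OF b0(2)] and w0 = below_viaD_word[OF b0(2)]
  have ysb0: "y * s * b0 = b0"
  proof -
    have "y * s * b0 = y * (s * y * u) * r * b0" using w0 by (simp add: mult.assoc)
    then show ?thesis unfolding syu using d0 by simp
  qed
  have sb0r: "s * b0 * r = u * (r * b0 * r)"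
  proof -
    have "s * b0 * r = (s * y * u) * r * b0 * r" using w0 by (simp add: mult.assoc)
    then show ?thesis unfolding syu by (simp add: mult.assoc)
  qed
  have "s * b0 * r \<sqsubset>[y] s"
    using d(5,6) d0(3) ysb0 by (rule below_via_conjugate)
  moreover have "r * b0 * r \<in> B\<^sup>\<star>"
    using star_shrink[OF coset_up[OF B, symmetric] b0(1,2)] .
  ultimately show ?thesis
    unfolding sb0r using u below_via_below upI set_times_intro by metis
qed

lemma star_mult_subset_star:
  assumes B: "B \<in> cosets N Z" and C: "C \<in> cosets N Z"
  shows "C\<^sup>\<star> * B\<^sup>\<star> \<subseteq> (B * C)\<^sup>\<star>"
proof
  fix x assume "x \<in> C\<^sup>\<star> * B\<^sup>\<star>"
  then obtain s t where x: "x = s * t" "s \<in> C\<^sup>\<star>" "t \<in> B\<^sup>\<star>" by (rule set_times_elim)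
  then obtain c c' b b' where "c \<in> C" "c \<sqsubset>[s] c'" "b \<in> B" "b \<sqsubset>[t] b'" by (auto simp: star_iff)
  then show "x \<in> (B * C)\<^sup>\<star>" using x below_via_mult starI set_times_intro by metis
qed

text \<open>
  Once inverses of products are known to factorise, a word in \<open>B * C\<close>, its inverses and \<open>B * C\<close> reduces to
  \<open>B * (C * C\<^sup>\<star>) * (B\<^sup>\<star> * B) * C\<close>, whose inner factors lie in the common unit coset.
\<close>

lemma mult_coset:
  assumes B: "B \<in> cosets N Z" and C: "C \<in> cosets N Z" and BC: "source B = range_unit C"
  shows "up (B * C) \<in> cosets N Z" and "(up (B * C))\<^sup>\<star> = up (C\<^sup>\<star> * B\<^sup>\<star>)"
proof -
  have r: "B * C \<subseteq> up (B * C)" by (intro rounded_mult coset_rounded B C)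
  have st: "(up (B * C))\<^sup>\<star> \<subseteq> up (C\<^sup>\<star> * B\<^sup>\<star>)"
    unfolding star_up[OF r]
    using inverse_factorises[OF B C BC] by (auto simp: star_iff elim!: set_times_elim)
  show coset: "up (B * C) \<in> cosets N Z"
  proof (rule cosetI)
    show "up (up (B * C)) = up (B * C)" using r by (rule up_up)
    show "up (B * C) \<noteq> {}" using r coset_nonempty[OF B] coset_nonempty[OF C]
      by (metis all_not_in_conv set_times_intro subset_empty)
    show "up (B * C) * (up (B * C))\<^sup>\<star> * up (B * C) \<subseteq> up (B * C)"
    proof
      fix x assume "x \<in> up (B * C) * (up (B * C))\<^sup>\<star> * up (B * C)"
      then obtain p q s where x: "x = p * s * q" "p \<in> up (B * C)" "s \<in> up (C\<^sup>\<star> * B\<^sup>\<star>)" "q \<in> up (B * C)"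
        using st by (auto elim!: set_times_elim)
      then obtain b c t r b' c' where
        l: "b * c \<sqsubset> p" "t * r \<sqsubset> s" "b' * c' \<sqsubset> q"
        and m: "b \<in> B" "c \<in> C" "t \<in> C\<^sup>\<star>" "r \<in> B\<^sup>\<star>" "b' \<in> B" "c' \<in> C"
        unfolding up_iff by (metis set_times_elim)
      have "c * t \<in> source B" using mult_star_in_range[OF C] m BC by metis
      then have "b * (c * t) \<in> B" using coset_mult_source[OF B] m by blast
      then have "b * (c * t) * r * b' \<in> B" using coset_mult[OF B] m by blast
      then have "(b * (c * t) * r * b') * c' \<in> B * C" using m by blast
      moreover have "(b * c) * (t * r) * (b' * c') \<sqsubset> x"
        unfolding x by (intro below_mult l)
      ultimately show "x \<in> up (B * C)" using upI by (simp add: mult.assoc)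
    qed
  qed
  have "up (C\<^sup>\<star> * B\<^sup>\<star>) \<subseteq> up ((up (B * C))\<^sup>\<star>)"
    using up_mono star_mult_subset_star[OF B C] star_up[OF r] by simp
  then show "(up (B * C))\<^sup>\<star> = up (C\<^sup>\<star> * B\<^sup>\<star>)"
    using st coset_up[OF star_coset[OF coset]] by simp
qed

section \<open>Unit cosets and translation\<close>

lemma star_source:
  assumes C: "C \<in> cosets N Z"
  shows "source C \<in> cosets N Z" and "(source C)\<^sup>\<star> = source C"
  using mult_coset[OF star_coset[OF C] C] source_star[OF C] star_star[OF C] by simp_all

definition unit_coset where
  "unit_coset U \<longleftrightarrow> U \<in> cosets N Z \<and> source U = U"

lemma source_mult:
  assumes B: "B \<in> cosets N Z" and C: "C \<in> cosets N Z" and BC: "source B = range_unit C"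
  shows "source (up (B * C)) = source C"
proof -
  note rC = coset_rounded[OF C] and rB = coset_rounded[OF B]
    and rC' = coset_rounded[OF star_coset[OF C]] and rB' = coset_rounded[OF star_coset[OF B]]
  have "source (up (B * C)) = up (C\<^sup>\<star> * B\<^sup>\<star> * (B * C))"
    unfolding mult_coset(2)[OF assms]
    by (intro up_mult_up rounded_mult rC rB rC' rB')
  also have "\<dots> = up (C\<^sup>\<star> * ((B\<^sup>\<star> * B) * C))" by (simp only: mult.assoc)
  also have "\<dots> = up (C\<^sup>\<star> * up ((B\<^sup>\<star> * B) * C))"
    by (intro up_mult_up_right[symmetric] rounded_mult rC rB rB' coset_up[symmetric] star_coset C)
  also have "up ((B\<^sup>\<star> * B) * C) = up (source B * C)"
    by (intro up_mult_up_left[symmetric] rounded_mult rC rB rB' coset_up[symmetric] C)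
  also have "up (source B * C) = C"
    unfolding BC by (rule range_mult_coset_up[OF C])
  finally show ?thesis .
qed

lemma range_mult:
  assumes B: "B \<in> cosets N Z" and C: "C \<in> cosets N Z" and BC: "source B = range_unit C"
  shows "range_unit (up (B * C)) = range_unit B"
  using source_mult[OF star_coset[OF C] star_coset[OF B]] assms mult_coset[OF B C BC]
  by (metis source_star range_star)

lemma unit_coset_source:
  assumes C: "C \<in> cosets N Z"
  shows "unit_coset (source C)"
  using source_mult[OF star_coset[OF C] C] source_star[OF C] star_source(1)[OF C]
  by (simp add: unit_coset_def)

lemma unit_coset_range:
  assumes C: "C \<in> cosets N Z"
  shows "unit_coset (range_unit C)"
  using unit_coset_source[OF star_coset[OF C]] source_star[OF C] by simp

lemma unit_cosetD:
  assumes "unit_coset U"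
  shows "U \<in> cosets N Z" "source U = U" "U\<^sup>\<star> = U" "x \<in> U \<Longrightarrow> y \<in> U \<Longrightarrow> x * y \<in> U"
proof -
  show U: "U \<in> cosets N Z" "source U = U" using assms by (simp_all add: unit_coset_def)
  then show "U\<^sup>\<star> = U" using star_source(2)[of U] by simp
  show "x \<in> U \<Longrightarrow> y \<in> U \<Longrightarrow> x * y \<in> U" using coset_mult_source[OF U(1)] U(2) by simp
qed

lemma unit_obtain:
  assumes U: "unit_coset U" "x \<in> U"
  obtains y v where "y \<in> U" "v \<in> U" "y \<sqsubset>[v] x"
  using rounded_obtain[OF coset_rounded[OF unit_cosetD(1)[OF U(1)]] U(2)] unit_cosetD(3)[OF U(1)] by metis

text \<open>
  If \<open>p\<close> lives where \<open>t * a\<close> is an identity, then \<open>t\<close> inverts \<open>a\<close> over \<open>a * p\<close>.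
\<close>

lemma mult_unit_below_via:
  assumes at: "a * t \<in> Z" "t * a \<in> Z" and p: "p \<in> N" "p * (t * a) = p"
  shows "a * p \<sqsubset>[t] a"
proof (rule below_viaI)
  have p': "t * a * p = p" using p at Z_commute by simp
  show "a * p * t * a = a * p" using p(2) by (simp add: mult.assoc)
  have "a * t * (a * p) = a * (t * a * p)" by (simp only: mult.assoc)
  then show "a * t * (a * p) = a * p" unfolding p' .
  have "p = p * t * a" using p(2) by (simp only: mult.assoc)
  from N_conj[OF p(1) p' this at(2,1)] show "a * p * t \<in> N" .
  have "t * (a * p) = t * a * p" by (simp only: mult.assoc)
  then show "t * (a * p) \<in> N" using p' p(1) by simp
qed (use at in auto)

text \<open>
  The same idea as for inverses of products, with \<open>a\<close> in place of the coset on the left: the inverses of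
  \<open>{a} * U\<close> should be generated by \<open>U * {t}\<close>. Here \<open>y * u\<close> plays the role of an element of the
  translate. It need not be of the form \<open>a * g\<close> with \<open>g \<in> U\<close>, so it is first
  multiplied by \<open>a * t\<close>, which gives \<open>a * g\<close> for \<open>g = t * (y * u)\<close>. An inverse of \<open>a * g\<close> over
  \<open>b = a * p * g0\<close> is \<open>r = h * t\<close>, with \<open>h\<close> inverting \<open>g\<close> in \<open>U\<close>. The price
  is that both \<open>s * y\<close> and its variant \<open>s * (a * t) * y\<close> have to be identities on \<open>u\<close>.
\<close>

lemma translate_inverse:
  assumes U: "unit_coset U" and at: "a * t \<in> Z" "t * a \<in> Z"
    and p: "p \<in> U" "p \<in> N" "p * (t * a) = p" and ta: "t * a \<in> U"
    and x: "x \<in> U" "a * x \<sqsubset>[s] y"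
  shows "s \<in> up (U * {t})"
proof -
  note Um = unit_cosetD(4)[OF U] and Uc = unit_cosetD(1)[OF U]
  have p': "t * a * p = p" using p at Z_commute by simp
  have p'': "t * (a * (p * w)) = p * w" for w using p' by (metis mult.assoc)
  note ap = mult_unit_below_via[OF at p(2,3)]
  have pt: "p * t \<sqsubset> t"
  proof -
    have "t * (a * p) * t \<sqsubset>[a] t" using below_via_dual[OF ap] .
    moreover have "t * (a * p) * t = p * t" using p' by (simp only: mult.assoc[symmetric])
    ultimately show ?thesis using below_via_below by metis
  qed
  obtain x0 where x0: "x0 \<in> U" "x0 \<sqsubset> x" using unit_obtain[OF U x(1)] below_via_below by metis
  \<comment> \<open>The factor \<open>p\<close> makes \<open>t * a\<close> an identity on \<open>x1\<close>.\<close>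
  define x1 where "x1 = p * x0"
  have x1: "x1 \<in> U" unfolding x1_def using Um p(1) x0(1) by blast
  have "a * x1 \<sqsubset> a * x" unfolding x1_def using below_mult[OF below_via_below[OF ap] x0(2)] by (simp add: mult.assoc)
  then have ax1: "a * x1 \<sqsubset>[s] y" using below_via_trans[OF _ x(2)] by (auto simp: below_def)
  note d = below_viaD[OF ax1]
  have tax1: "t * (a * x1) = x1" unfolding x1_def by (rule p'')
  have xsy: "x1 * (s * y) = x1"
  proof -
    have "x1 * (s * y) = t * (a * x1 * s * y)" using tax1 by (metis mult.assoc)
    then show ?thesis using d(1) tax1 by simp
  qed
  have xsaty: "x1 * (s * (a * t) * y) = x1"
  proof -
    have "x1 * (s * (a * t) * y) = t * ((a * x1 * s) * (a * t)) * y" using tax1 by (metis mult.assoc)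
    also have "\<dots> = t * ((a * t) * (a * x1 * s)) * y" using Z_commute[OF at(1) d(3)] by simp
    also have "\<dots> = t * a * t * (a * x1 * s * y)" by (simp only: mult.assoc)
    also have "\<dots> = t * (a * (t * (a * x1)))" unfolding d(1) by (simp only: mult.assoc)
    finally show ?thesis unfolding tax1 .
  qed
  obtain c v where c: "c \<in> U" "v \<in> U" "c \<sqsubset>[v] x1" using unit_obtain[OF U x1] .
  note dc = below_viaD[OF c(3)]
  define u where "u = v * c * v"
  have u: "u \<in> U" unfolding u_def using Um c by blast
  have zu: "z * u = u" if z: "z \<in> Z" "x1 * z = x1" for z
  proof -
    have "c * z = c * v * (x1 * z)" using dc(1) by (metis mult.assoc)
    then have cz: "c * z = c" using z dc(1) by simp
    have "z * u = z * (v * c) * v" unfolding u_def by (simp only: mult.assoc)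
    also have "\<dots> = v * (c * z) * v" using Z_commute[OF z(1) dc(4)] by (simp add: mult.assoc)
    finally show ?thesis unfolding cz u_def .
  qed
  have syu: "s * y * u = u" using zu[OF d(6) xsy] .
  have satyu: "s * (a * t) * y * u = u" using zu[OF Z_conjugate[OF d(6,5) at(1)] xsaty] .
  obtain u' where u': "u' \<in> U" "u' \<sqsubset> u" using unit_obtain[OF U u] below_via_below by metis
  define g where "g = t * (y * u)"
  have "p * (x1 * u') \<in> U" using Um p(1) x1 u'(1) by blast
  moreover have "p * (x1 * u') \<sqsubset> g"
  proof -
    have "p * t * (a * x1 * u') \<sqsubset> g" unfolding g_def
      by (intro below_mult pt below_via_below[OF ax1] u')
    moreover have "p * t * (a * x1 * u') = p * ((t * (a * x1)) * u')" by (simp only: mult.assoc)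
    ultimately show ?thesis unfolding tax1 by simp
  qed
  ultimately have "g \<in> U" using coset_upward[OF Uc] by blast
  then obtain g0 h where g0: "g0 \<in> U" "h \<in> U" "g0 \<sqsubset>[h] g" by (rule unit_obtain[OF U])
  define b r where "b = a * p * g0" and "r = h * t"
  have b: "b \<sqsubset>[r] a * g" unfolding b_def r_def by (rule below_via_mult[OF ap g0(3)])
  note db = below_viaD[OF b]
  have "y * s * (a * g) = ((y * s) * (a * t)) * (y * u)" unfolding g_def by (simp only: mult.assoc)
  also have "\<dots> = (a * t) * y * (s * y * u)"
    using Z_commute[OF d(5) Z_in_N[OF at(1)]] by (simp add: mult.assoc)
  also have "\<dots> = a * g" unfolding syu g_def by (simp only: mult.assoc)
  finally have ysag: "y * s * (a * g) = a * g" .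
  have "y * s * b = y * s * (a * g) * r * b" using db(2) by (metis mult.assoc)
  then have "y * s * b = b" unfolding ysag db(2) .
  then have sbr: "s * b * r \<sqsubset>[y] s" using d(5,6) db(3) by (intro below_via_conjugate)
  have "s * b * r = s * (a * g * r * b) * r" unfolding db(2) ..
  also have "\<dots> = (s * (a * t) * y * u) * h * (t * (a * (p * g0))) * h * t"
    unfolding g_def b_def r_def by (simp only: mult.assoc)
  also have "\<dots> = u * h * (p * g0) * h * t" unfolding satyu p'' ..
  finally have "s * b * r = u * h * (p * g0) * h * t" .
  moreover have "u * h * (p * g0) * h \<in> U" using Um u g0 p by blast
  ultimately have "s * b * r \<in> U * {t}" by (metis set_times_intro singletonI)
  then show ?thesis using sbr below_via_below upI by blast
qed

text \<open>
  The element \<open>p\<close> marks where \<open>t\<close> inverts \<open>a\<close>; as it lies in \<open>U\<close>, so does \<open>t * a\<close>, and the inverses of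
  \<open>{a} * U\<close> are generated by \<open>U * {t}\<close>. The translate is thus the analogue of \<open>a\<close> times the unit described
  by \<open>U\<close>.
\<close>

lemma translate:
  assumes U: "unit_coset U" and at: "a * t \<in> Z" "t * a \<in> Z"
    and p: "p \<in> U" "p \<in> N" "p * (t * a) = p"
  defines "X \<equiv> up ({a} * U)"
  shows "X \<in> cosets N Z" and "a \<in> X" and "t \<in> X\<^sup>\<star>" and "source X = U"
proof -
  note Um = unit_cosetD(4)[OF U] and Uc = unit_cosetD(1)[OF U]
  have p': "t * a * p = p" using p at Z_commute by simp
  note ap = mult_unit_below_via[OF at p(2,3)]
  have ta: "t * a \<in> U"
  proof -
    obtain q v where q: "q \<in> U" "v \<in> U" "q \<sqsubset>[v] p" using unit_obtain[OF U p(1)] .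
    note d = below_viaD[OF q(3)]
    have qta: "q * (t * a) = q" using d(1) p(3) by (metis mult.assoc)
    have "v * q \<sqsubset>[v * p] t * a"
    proof (rule below_viaI)
      have e: "v * q * (v * p) = v * q" using d(1) by (simp add: mult.assoc)
      then show "v * q * (v * p) \<in> N" "v * p * (v * q) \<in> N"
        using Z_commute[OF d(6,4)] d(4) by simp_all
      show "v * q * (v * p) * (t * a) = v * q" unfolding e using qta by (simp add: mult.assoc)
      have "v * p * (v * q) = v * q" using e Z_commute[OF d(6,4)] by simp
      then have "t * a * (v * p) * (v * q) = t * a * (v * q)" by (simp add: mult.assoc)
      also have "\<dots> = v * (q * (t * a))" using Z_commute[OF at(2) d(4)] by (simp add: mult.assoc)
      finally show "t * a * (v * p) * (v * q) = v * q" unfolding qta .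
    qed (use Z_mult_closed d at in auto)
    then show ?thesis using q Um coset_upward[OF Uc] below_via_below by blast
  qed
  have memX: "a * x \<in> {a} * U" if "x \<in> U" for x using that by blast
  have rX: "{a} * U \<subseteq> up ({a} * U)"
  proof
    fix z assume "z \<in> {a} * U"
    then obtain x where x: "z = a * x" "x \<in> U" by (auto elim: set_times_elim)
    then obtain x0 where x0: "x0 \<in> U" "x0 \<sqsubset> x" using unit_obtain[OF U] below_via_below by metis
    then have "a * (p * x0) \<in> {a} * U" using memX Um p by blast
    moreover have "a * (p * x0) \<sqsubset> z"
      unfolding x using below_mult[OF below_via_below[OF ap] x0(2)] by (simp add: mult.assoc)
    ultimately show "z \<in> up ({a} * U)" by (rule upI)
  qed
  have star1: "X\<^sup>\<star> \<subseteq> up (U * {t})"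
  proof
    fix s assume "s \<in> X\<^sup>\<star>"
    then obtain z y where "z \<in> {a} * U" "z \<sqsubset>[s] y" unfolding X_def star_up[OF rX] by (auto simp: star_iff)
    then obtain x where "x \<in> U" "a * x \<sqsubset>[s] y" by (auto elim: set_times_elim)
    then show "s \<in> up (U * {t})" by (rule translate_inverse[OF U at p ta])
  qed
  have star2: "U * {t} \<subseteq> X\<^sup>\<star>"
  proof
    fix s assume "s \<in> U * {t}"
    then obtain x where x: "s = x * t" "x \<in> U\<^sup>\<star>" using unit_cosetD(3)[OF U] by (auto elim: set_times_elim)
    then obtain w w' where w: "w \<in> U" "w \<sqsubset>[x] w'" by (auto simp: star_iff)
    have "a * (p * w) \<in> {a} * U" using memX w p Um by blast
    moreover have "a * (p * w) \<sqsubset>[s] a * w'" using below_via_mult[OF ap w(2)] x by (simp add: mult.assoc)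
    ultimately show "s \<in> X\<^sup>\<star>" unfolding X_def star_up[OF rX] by (rule starI)
  qed
  have "a * p \<in> X" using rX memX[OF p(1)] X_def by blast
  then show "t \<in> X\<^sup>\<star>" using ap starI by blast
  show aX: "a \<in> X" unfolding X_def using upI[OF memX[OF p(1)] below_via_below[OF ap]] .
  show coset: "X \<in> cosets N Z"
  proof (rule cosetI)
    show "up X = X" unfolding X_def using up_up[OF rX] .
    show "X \<noteq> {}" using aX by blast
    show "X * X\<^sup>\<star> * X \<subseteq> X"
    proof
      fix z assume "z \<in> X * X\<^sup>\<star> * X"
      then obtain k s l where z: "z = k * s * l" "k \<in> X" "s \<in> X\<^sup>\<star>" "l \<in> X" by (metis set_times_elim)
      have "s \<in> up (U * {t})" using star1 z(3) by blast
      then obtain w where w: "w \<in> U" "w * t \<sqsubset> s" by (auto simp: up_iff elim!: set_times_elim)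
      obtain x x' where "x \<in> U" "x' \<in> U" "a * x \<sqsubset> k" "a * x' \<sqsubset> l"
        using z(2,4) unfolding X_def by (auto simp: up_iff elim!: set_times_elim)
      note m = this(1) w(1) this(2) and l = this(3) w(2) this(4)
      have "x * w * (t * a) * x' \<in> U" using Um m ta by blast
      from memX[OF this] have "(a * x) * (w * t) * (a * x') \<in> {a} * U" by (simp add: mult.assoc)
      moreover have "(a * x) * (w * t) * (a * x') \<sqsubset> z" unfolding z by (intro below_mult l)
      ultimately show "z \<in> X" unfolding X_def by (rule upI)
    qed
  qed
  have star: "X\<^sup>\<star> = up (U * {t})"
    using star1 up_mono[OF star2] coset_up[OF star_coset[OF coset]] by blast
  have "source X = up (up (U * {t}) * X)" unfolding star ..
  also have "\<dots> = up ((U * {t}) * ({a} * U))"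
    unfolding X_def using star2 star rX by (intro up_mult_up) auto
  also have "\<dots> = U"
  proof
    have "(U * {t}) * ({a} * U) \<subseteq> U"
    proof
      fix z assume "z \<in> (U * {t}) * ({a} * U)"
      then obtain x x' where "x \<in> U" "x' \<in> U" "z = x * t * (a * x')" by (auto elim!: set_times_elim)
      then show "z \<in> U" using Um[OF Um[OF _ ta], of x x'] by (simp add: mult.assoc)
    qed
    from up_mono[OF this] show "up ((U * {t}) * ({a} * U)) \<subseteq> U" unfolding coset_up[OF Uc] .
    show "U \<subseteq> up ((U * {t}) * ({a} * U))"
    proof
      fix x assume "x \<in> U"
      then obtain y v where y: "y \<in> U" "y \<sqsubset>[v] x" by (rule unit_obtain[OF U])
      have "p * y = p * t * (a * y)" using p(3) by (metis mult.assoc)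
      then have "p * y \<in> (U * {t}) * ({a} * U)" using p(1) y(1) by (metis set_times_intro singletonI)
      then show "x \<in> up ((U * {t}) * ({a} * U))"
        using N_mult_below_via[OF p(2) y(2)] below_via_below upI by blast
    qed
  qed
  finally show "source X = U" .
qed

text \<open>
  For \<open>c0 \<sqsubset> c\<close> in \<open>C\<close> and an inverse \<open>s\<close> of \<open>a\<close>, the product \<open>a * s\<close> is in \<open>N\<close>, so
  \<open>a * (s * c0)\<close> is still below \<open>c\<close>, while \<open>s * c0\<close> belongs to the source. Hence a coset is determined by
  its source and any one of its elements, which is the reason why \<open>\<C>\<^sub>a\<close> is a slice.
\<close>

lemma coset_eq_translate:
  assumes C: "C \<in> cosets N Z" and a: "a \<in> C"
  shows "C = up ({a} * source C)"
proof
  show "up ({a} * source C) \<subseteq> C"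
  proof
    fix z assume "z \<in> up ({a} * source C)"
    then obtain u where "u \<in> source C" "a * u \<sqsubset> z" by (auto simp: up_iff[of z] elim!: set_times_elim)
    then show "z \<in> C" using coset_mult_source[OF C a] coset_upward[OF C] by blast
  qed
  show "C \<subseteq> up ({a} * source C)"
  proof
    fix c assume "c \<in> C"
    then obtain c0 v where c0: "c0 \<in> C" "c0 \<sqsubset>[v] c" using rounded_obtain[OF coset_rounded[OF C]] by metis
    obtain e s where e: "e \<in> C" "e \<sqsubset>[s] a" "s \<in> C\<^sup>\<star>" using rounded_obtain[OF coset_rounded[OF C] a] .
    have "s * c0 \<in> source C" using star_mult_in_source[OF C] e c0 by blast
    then have "a * (s * c0) \<in> {a} * source C" by blast
    moreover have "a * (s * c0) \<sqsubset> c"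
      using N_mult_below_via[OF Z_in_N[OF below_viaD(5)[OF e(2)]] c0(2)] below_via_below by (simp add: mult.assoc)
    ultimately show "c \<in> up ({a} * source C)" by (rule upI)
  qed
qed

lemma coset_eq_translate_range:
  assumes C: "C \<in> cosets N Z" and a: "a \<in> C"
  shows "C = up (range_unit C * {a})"
proof
  show "up (range_unit C * {a}) \<subseteq> C"
  proof
    fix z assume "z \<in> up (range_unit C * {a})"
    then obtain u where "u \<in> range_unit C" "u * a \<sqsubset> z" by (auto simp: up_iff[of z] elim!: set_times_elim)
    then show "z \<in> C" using range_mult_coset[OF C _ a] coset_upward[OF C] by blast
  qed
  show "C \<subseteq> up (range_unit C * {a})"
  proof
    fix c assume "c \<in> C"
    then obtain c0 v where c0: "c0 \<in> C" "c0 \<sqsubset>[v] c" using rounded_obtain[OF coset_rounded[OF C]] by metis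
    obtain e s where e: "e \<in> C" "e \<sqsubset>[s] a" "s \<in> C\<^sup>\<star>" using rounded_obtain[OF coset_rounded[OF C] a] .
    have "c0 * s \<in> range_unit C" using mult_star_in_range[OF C] e c0 by blast
    then have "c0 * s * a \<in> range_unit C * {a}" by blast
    moreover have "c0 * s * a \<sqsubset> c"
      using below_via_mult_N[OF Z_in_N[OF below_viaD(6)[OF e(2)]] c0(2)] below_via_below by (simp add: mult.assoc)
    ultimately show "c \<in> up (range_unit C * {a})" by (rule upI)
  qed
qed

lemma coset_eqI_source:
  assumes "B \<in> cosets N Z" "C \<in> cosets N Z" "a \<in> B" "a \<in> C" "source B = source C"
  shows "B = C"
  using coset_eq_translate assms by metis

lemma coset_eqI_range:
  assumes "B \<in> cosets N Z" "C \<in> cosets N Z" "a \<in> B" "a \<in> C" "range_unit B = range_unit C"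
  shows "B = C"
  using coset_eq_translate_range assms by metis

text \<open>
  Multiplying by \<open>n \<in> N\<close> only shrinks elements. So an element \<open>x\<close> of the source is above an element
  \<open>n * y\<close> of \<open>C\<close>, which puts the source inside \<open>C\<close>. Two cosets that meet and have the same source
  coincide.
\<close>

lemma coset_meets_N:
  assumes C: "C \<in> cosets N Z" and n: "n \<in> C" "n \<in> N"
  shows "unit_coset C"
proof -
  note U = unit_coset_source[OF C]
  have sub: "source C \<subseteq> C"
  proof
    fix x assume "x \<in> source C"
    then obtain y v where y: "y \<in> source C" "y \<sqsubset>[v] x" by (rule unit_obtain[OF U])
    have "n * y \<in> C" using coset_mult_source[OF C n(1) y(1)] .
    then show "x \<in> C" using N_mult_below_via[OF n(2) y(2)] coset_upward[OF C] below_via_below by blast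
  qed
  obtain u where "u \<in> source C" using coset_nonempty[OF unit_cosetD(1)[OF U]] by blast
  then have "source C = C"
    using coset_eqI_source[OF unit_cosetD(1)[OF U] C _ _ unit_cosetD(2)[OF U]] sub by blast
  then show ?thesis using U by simp
qed

text \<open>
  If \<open>s\<close> inverts \<open>a * b\<close> over \<open>c \<in> C\<close>, then \<open>a * (b * s)\<close> is in \<open>Z\<close>, but \<open>b * s * a\<close>
  need not be. Symmetry of \<open>Z\<close> puts its square there, so \<open>t = b * s * a * b * s\<close> is an inverse of \<open>a\<close>
  around \<open>p = c * s\<close>. Translating the range of \<open>C\<close> by \<open>t\<close> gives a coset \<open>Y\<close> whose inverse contains
  \<open>a\<close>, and the second factor has to be \<open>up (Y * C)\<close>. It contains \<open>b\<close> because
  \<open>s * a * b * s * a\<close> inverts \<open>b\<close> over \<open>b * s * c\<close>, again by symmetry.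
\<close>

lemma mult_factor:
  assumes sym: "symmetric_set Z" and C: "C \<in> cosets N Z" and ab: "a * b \<in> C"
  shows "\<exists>D\<in>cosets N Z. \<exists>E\<in>cosets N Z. a \<in> D \<and> b \<in> E \<and> source D = range_unit E \<and> C = up (D * E)"
proof -
  obtain c s where c: "c \<in> C" "c \<sqsubset>[s] a * b" "s \<in> C\<^sup>\<star>" using rounded_obtain[OF coset_rounded[OF C] ab] .
  note d = below_viaD[OF c(2)]
  define U where "U = range_unit C"
  have U: "unit_coset U" unfolding U_def using unit_coset_range[OF C] .
  define t where "t = b * s * a * b * s"
  have Zsym: "x * y \<in> Z \<Longrightarrow> y * x * y * x \<in> Z" for x y using sym by (simp add: symmetric_set_def)
  have "a * t = (a * b * s) * (a * b * s)" by (simp only: t_def mult.assoc)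
  then have at: "a * t \<in> Z" using Z_mult_closed d by simp
  have ta: "t * a \<in> Z" using Zsym[of a "b * s"] d by (simp add: t_def mult.assoc)
  define p where "p = c * s"
  have p: "p \<in> U" "p \<in> N" unfolding p_def U_def using mult_star_in_range[OF C] c d by auto
  have pat: "p * (a * t) = p"
  proof -
    have "p * (a * t) = (a * t) * p" using Z_commute at p by simp
    also have "\<dots> = a * b * s * (a * b * s * c) * s" by (simp only: t_def p_def mult.assoc)
    finally show ?thesis using d by (simp add: p_def)
  qed
  \<comment> \<open>\<open>a\<close> and \<open>t\<close> are exchanged here: the translate by \<open>t\<close> is the inverse of the coset sought for \<open>a\<close>.\<close>
  define Y where "Y = up ({t} * U)"
  note Y = translate[OF U ta at p pat, folded Y_def]
  have YC: "source Y = range_unit C" using Y(4) by (simp add: U_def)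
  define E where "E = up (Y * C)"
  note E = mult_coset[OF Y(1) C YC, folded E_def]
  have "source (Y\<^sup>\<star>) = range_unit E"
    using source_star[OF Y(1)] range_mult[OF Y(1) C YC] by (simp add: E_def)
  moreover have "C = up (Y\<^sup>\<star> * E)"
  proof -
    have "up (Y\<^sup>\<star> * E) = up (Y\<^sup>\<star> * Y * C)" unfolding E_def mult.assoc
      by (intro up_mult_up_right rounded_mult coset_rounded coset_up[symmetric] Y(1) C star_coset)
    also have "\<dots> = up (source Y * C)"
      by (intro up_mult_up_left[symmetric] rounded_mult coset_rounded coset_up[symmetric] Y(1) C star_coset)
    finally show ?thesis unfolding YC range_mult_coset_up[OF C] ..
  qed
  moreover have "b \<in> E"
  proof -
    define t' where "t' = s * a * b * s * a"
    have t'b: "t' * b \<in> Z" using Z_mult_closed[OF d(6) d(6)] by (simp add: t'_def mult.assoc)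
    have bt': "b * t' \<in> Z" using Zsym[of a "b * s"] d by (simp add: t'_def mult.assoc)
    have "b * s * c \<sqsubset>[t'] b"
    proof (rule below_viaI)
      have "c * s * (a * b) * s * (a * b) = c" using d by simp
      then show "b * s * c * t' * b = b * s * c" unfolding t'_def by (metis mult.assoc)
      have e: "a * b * s * (a * b * s * c) = c" using d by simp
      then show "b * t' * (b * s * c) = b * s * c" unfolding t'_def by (metis mult.assoc)
      have "t' * (b * s * c) = s * (a * b * s * (a * b * s * c))" unfolding t'_def by (simp only: mult.assoc)
      then show "t' * (b * s * c) \<in> N" unfolding e using d by simp
      have pat': "a * t * p = p" using pat Z_commute[OF at p(2)] by simp
      have "p = p * a * t" using pat by (simp only: mult.assoc)
      from N_conj[OF p(2) pat' this at ta] have "t * p * a \<in> N" .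
      moreover have "t * p * a = b * s * (a * b * s * c) * s * a" unfolding t_def p_def by (simp only: mult.assoc)
      moreover have "b * s * c * t' = b * s * (c * s * (a * b)) * s * a" unfolding t'_def by (simp only: mult.assoc)
      then have "b * s * c * t' = b * s * c * s * a" unfolding d(1) .
      ultimately show "b * s * c * t' \<in> N" using d by simp
    qed (use bt' t'b in auto)
    from below_via_mult_N[OF d(4) this] have below: "b * s * c * (s * c) \<sqsubset> b" by (rule below_via_below)
    have "t * p \<in> Y" using coset_mult_source[OF Y(1) Y(2)] Y(4) p by simp
    then have "t * p * c \<in> Y * C" using c by blast
    moreover have "t * p * c = b * s * (a * b * s * c) * s * c" unfolding t_def p_def by (simp only: mult.assoc)
    then have "t * p * c = b * s * c * (s * c)" unfolding d(2) by (simp only: mult.assoc)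
    ultimately show ?thesis unfolding E_def using below upI by metis
  qed
  ultimately show ?thesis using Y(3) star_coset[OF Y(1)] E(1) by blast
qed

section \<open>The etale groupoid of cosets\<close>

abbreviation coset_gpd where "coset_gpd \<equiv> coset_groupoid N Z"

lemma coset_groupoid_simps [simp]:
  "arrows coset_gpd = cosets N Z"
  "gmult coset_gpd B C = up (B * C)"
  "ginv coset_gpd C = C\<^sup>\<star>"
  "gtop coset_gpd = topology_generated_by (range (coset_map N Z))"
  "src coset_gpd C = source C"
  "rng coset_gpd C = range_unit C"
  by (simp_all add: coset_groupoid_def src_def rng_def)

lemma composable_coset_groupoid [simp]:
  "(B, C) \<in> composable coset_gpd \<longleftrightarrow> B \<in> cosets N Z \<and> C \<in> cosets N Z \<and> source B = range_unit C"
  by (simp add: composable_def)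

lemma gunits_coset_groupoid: "U \<in> gunits coset_gpd \<longleftrightarrow> unit_coset U"
proof
  assume "unit_coset U"
  then have "U = src coset_gpd U" "U \<in> arrows coset_gpd" using unit_cosetD by simp_all
  then show "U \<in> gunits coset_gpd" unfolding gunits_def by (rule image_eqI)
qed (auto simp: gunits_def unit_coset_source)

lemma groupoid_cosets: "groupoid coset_gpd"
proof
  fix A B C :: "'a set"
  assume "(A, B) \<in> composable coset_gpd" "(B, C) \<in> composable coset_gpd"
  then have c: "A \<in> cosets N Z" "B \<in> cosets N Z" "C \<in> cosets N Z" by simp_all
  note r = coset_rounded[OF c(1)] coset_rounded[OF c(2)] coset_rounded[OF c(3)]
  have "up (up (A * B) * C) = up (A * B * C)"
    by (intro up_mult_up_left rounded_mult r coset_up[symmetric] c)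
  moreover have "up (A * up (B * C)) = up (A * (B * C))"
    by (intro up_mult_up_right rounded_mult r coset_up[symmetric] c)
  ultimately show "gmult coset_gpd (gmult coset_gpd A B) C = gmult coset_gpd A (gmult coset_gpd B C)"
    by (simp add: mult.assoc)
qed (simp_all add: star_coset star_star mult_coset(1) source_mult range_mult
      coset_mult_source_up range_mult_coset_up)

lemma openin_coset_map: "openin (gtop coset_gpd) (coset_map N Z a)"
  by (simp add: topology_generated_by_Basis)

lemma coset_map_iff: "C \<in> coset_map N Z a \<longleftrightarrow> C \<in> cosets N Z \<and> a \<in> C"
  by (simp add: coset_map_def)

lemma Union_coset_map: "(\<Union>a. coset_map N Z a) = cosets N Z"
  using coset_nonempty by (fastforce simp: coset_map_iff)

lemma topspace_coset_groupoid: "topspace (gtop coset_gpd) = cosets N Z"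
  using Union_coset_map by simp

lemma continuous_map_into_cosets:
  assumes "\<And>x. x \<in> topspace T \<Longrightarrow> f x \<in> cosets N Z"
    and "\<And>a. openin T {x \<in> topspace T. a \<in> f x}"
  shows "continuous_map T (gtop coset_gpd) f"
  unfolding coset_groupoid_simps
proof (rule continuous_on_generated_topo)
  show "f ` topspace T \<subseteq> \<Union> (range (coset_map N Z))"
    using assms(1) Union_coset_map by auto
  fix O' assume "O' \<in> range (coset_map N Z)"
  then obtain a where "O' = coset_map N Z a" by blast
  then have "f -` O' \<inter> topspace T = {x \<in> topspace T. a \<in> f x}"
    using assms(1) by (auto simp: coset_map_iff)
  then show "openin T (f -` O' \<inter> topspace T)" using assms(2) by simp
qed

text \<open>
  The sets of cosets containing a fixed finite \<open>F \<subseteq> S\<close> are the finite intersections of subbasic sets; \<open>F = {}\<close>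
  gives the whole space.
\<close>

lemma openin_coset_groupoid_base:
  assumes "openin (gtop coset_gpd) W" "C \<in> W"
  shows "\<exists>F. finite F \<and> F \<subseteq> C \<and> (\<forall>D\<in>cosets N Z. F \<subseteq> D \<longrightarrow> D \<in> W)"
proof -
  have "generate_topology_on (range (coset_map N Z)) W"
    using assms(1) by (simp add: openin_topology_generated_by_iff)
  then show ?thesis using assms(2)
  proof (induction arbitrary: C rule: generate_topology_on.induct)
    case (Int a b)
    then obtain F F' where F: "finite F" "F \<subseteq> C" "\<forall>D\<in>cosets N Z. F \<subseteq> D \<longrightarrow> D \<in> a"
      "finite F'" "F' \<subseteq> C" "\<forall>D\<in>cosets N Z. F' \<subseteq> D \<longrightarrow> D \<in> b" by (metis IntE)
    then show ?case by (intro exI[of _ "F \<union> F'"]) auto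
  next
    case (UN K)
    then obtain k where k: "k \<in> K" "C \<in> k" by blast
    obtain F where "finite F" "F \<subseteq> C" "\<forall>D\<in>cosets N Z. F \<subseteq> D \<longrightarrow> D \<in> k"
      using UN.IH[OF k] by blast
    with k(1) show ?case by (intro exI[of _ F]) auto
  next
    case (Basis s)
    then obtain a where "s = coset_map N Z a" by blast
    with Basis show ?case by (intro exI[of _ "{a}"]) (auto simp: coset_map_iff)
  qed simp
qed

lemma openin_finite_coset_nbhd:
  assumes "finite F"
  shows "openin (gtop coset_gpd) {D \<in> cosets N Z. F \<subseteq> D}"
  using assms
proof induction
  case empty
  show ?case using openin_topspace[of "gtop coset_gpd"] topspace_coset_groupoid by simp
next
  case (insert a F)
  have "{D \<in> cosets N Z. insert a F \<subseteq> D} = coset_map N Z a \<inter> {D \<in> cosets N Z. F \<subseteq> D}"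
    by (auto simp: coset_map_iff)
  then show ?case using insert.IH openin_coset_map openin_Int by metis
qed

lemma continuous_coset_star: "continuous_map (gtop coset_gpd) (gtop coset_gpd) (ginv coset_gpd)"
proof (rule continuous_map_into_cosets)
  fix a
  have "{C \<in> cosets N Z. a \<in> C\<^sup>\<star>} = (\<Union>x\<in>{x. \<exists>y. x \<sqsubset>[a] y}. coset_map N Z x)"
    by (auto simp: star_iff coset_map_iff)
  also have "openin (gtop coset_gpd) \<dots>" using openin_coset_map by (intro openin_Union) auto
  finally show "openin (gtop coset_gpd) {C \<in> topspace (gtop coset_gpd). a \<in> ginv coset_gpd C}"
    unfolding topspace_coset_groupoid by simp
qed (simp add: star_coset Union_coset_map)

lemma continuous_coset_mult: "continuous_map (subtopology (prod_topology (gtop coset_gpd) (gtop coset_gpd)) (composable coset_gpd))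
   (gtop coset_gpd) (\<lambda>(B, C). gmult coset_gpd B C)"
proof (rule continuous_map_into_cosets)
  let ?T = "subtopology (prod_topology (gtop coset_gpd) (gtop coset_gpd)) (composable coset_gpd)"
  have comp: "topspace ?T = composable coset_gpd"
    by (auto simp: topspace_coset_groupoid topspace_subtopology simp del: coset_groupoid_simps(4))
  show "(case x of (B, C) \<Rightarrow> gmult coset_gpd B C) \<in> cosets N Z" if "x \<in> topspace ?T" for x
    using that unfolding comp by (cases x) (simp add: mult_coset(1))
  fix a
  let ?W = "\<Union>(b, c)\<in>{(b, c). b * c \<sqsubset> a}. coset_map N Z b \<times> coset_map N Z c"
  have "openin (prod_topology (gtop coset_gpd) (gtop coset_gpd)) ?W"
    using openin_coset_map by (intro openin_Union) (auto simp: openin_prod_Times_iff)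
  moreover have "{x \<in> topspace ?T. a \<in> (case x of (B, C) \<Rightarrow> gmult coset_gpd B C)} = composable coset_gpd \<inter> ?W"
  proof -
    have "a \<in> up (B * C) \<longleftrightarrow> (B, C) \<in> ?W" if "(B, C) \<in> composable coset_gpd" for B C
    proof
      assume "a \<in> up (B * C)"
      then obtain b c where "b \<in> B" "c \<in> C" "b * c \<sqsubset> a" unfolding up_mult_iff by blast
      with that show "(B, C) \<in> ?W" by (intro UN_I[of "(b, c)"]) (simp_all add: coset_map_iff)
    qed (auto simp: coset_map_iff intro: upI)
    then have "a \<in> gmult coset_gpd (fst x) (snd x) \<longleftrightarrow> x \<in> ?W" if "x \<in> composable coset_gpd" for x
      using that by (metis coset_groupoid_simps(2) prod.collapse)
    then show ?thesis unfolding comp case_prod_beta by blast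
  qed
  ultimately show "openin ?T {x \<in> topspace ?T. a \<in> (case x of (B, C) \<Rightarrow> gmult coset_gpd B C)}"
    by (simp add: openin_subtopology_Int2)
qed

text \<open>
  Let \<open>C\<close> be in the open set \<open>W\<close>, with source \<open>U\<close>. Membership in \<open>W\<close> is ensured by finitely many elements
  \<open>f\<close> of \<open>C = up ({a} * U)\<close>, each of which is above some \<open>a * u f\<close> with \<open>u f \<in> U\<close>. Any coset \<open>D\<close>
  containing these \<open>u f\<close> and the element \<open>t * e\<close> of \<open>N\<close> is a unit coset along which \<open>a\<close> can be translated. The
  translate has source \<open>D\<close> and contains every \<open>f\<close>, hence is in \<open>W\<close>.
\<close>

lemma open_map_source: "open_map (gtop coset_gpd) (gtop coset_gpd) (src coset_gpd)"
  unfolding open_map_def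
proof (intro allI impI)
  fix W assume W: "openin (gtop coset_gpd) W"
  show "openin (gtop coset_gpd) (src coset_gpd ` W)"
  proof (subst openin_subopen, intro ballI)
    fix U assume "U \<in> src coset_gpd ` W"
    then obtain C where C: "C \<in> W" "U = source C" by auto
    have coset: "C \<in> cosets N Z" using openin_subset[OF W] C topspace_coset_groupoid by blast
    obtain F where F: "finite F" "F \<subseteq> C" "\<And>D. D \<in> cosets N Z \<Longrightarrow> F \<subseteq> D \<Longrightarrow> D \<in> W"
      using openin_coset_groupoid_base[OF W C(1)] by blast
    obtain a where a: "a \<in> C" using coset_nonempty[OF coset] by blast
    obtain e t where e: "e \<in> C" "e \<sqsubset>[t] a" "t \<in> C\<^sup>\<star>" using rounded_obtain[OF coset_rounded[OF coset] a] .
    note d = below_viaD[OF e(2)]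
    have p: "t * e \<in> U" "t * e \<in> N" "t * e * (t * a) = t * e"
      using star_mult_in_source[OF coset] e d C by (auto simp: mult.assoc)
    have "\<forall>f\<in>F. \<exists>u\<in>U. a * u \<sqsubset> f"
    proof
      fix f assume "f \<in> F"
      then have "f \<in> up ({a} * U)" using F(2) coset_eq_translate[OF coset a] C(2) by blast
      then show "\<exists>u\<in>U. a * u \<sqsubset> f" by (auto simp: up_iff elim: set_times_elim)
    qed
    then obtain u where u: "\<And>f. f \<in> F \<Longrightarrow> u f \<in> U \<and> a * u f \<sqsubset> f" by metis
    let ?V = "{D \<in> cosets N Z. insert (t * e) (u ` F) \<subseteq> D}"
    have "openin (gtop coset_gpd) ?V" using F(1) by (intro openin_finite_coset_nbhd) simp
    moreover have "U \<in> ?V" using u p C(2) star_source(1)[OF coset] by auto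
    moreover have "?V \<subseteq> src coset_gpd ` W"
    proof
      fix D assume "D \<in> ?V"
      then have D: "D \<in> cosets N Z" "t * e \<in> D" "u ` F \<subseteq> D" by auto
      have unit: "unit_coset D" using coset_meets_N[OF D(1,2) p(2)] .
      note X = translate[OF unit d(5,6) D(2) p(2,3)]
      have "F \<subseteq> up ({a} * D)"
      proof
        fix f assume f: "f \<in> F"
        then have "a * u f \<in> {a} * D" using D(3) by blast
        then show "f \<in> up ({a} * D)" using u[OF f] upI by blast
      qed
      then have "up ({a} * D) \<in> W" using F(3) X(1) by blast
      moreover have "D = src coset_gpd (up ({a} * D))" using X(4) by simp
      ultimately show "D \<in> src coset_gpd ` W" by (rule rev_image_eqI)
    qed
    ultimately show "\<exists>T. openin (gtop coset_gpd) T \<and> U \<in> T \<and> T \<subseteq> src coset_gpd ` W" by blast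
  qed
qed

lemma etale_groupoid_cosets: "etale_groupoid coset_gpd"
proof -
  interpret groupoid coset_gpd by (rule groupoid_cosets)
  show ?thesis
  proof unfold_locales
    show "topspace (gtop coset_gpd) = arrows coset_gpd" using topspace_coset_groupoid by simp
  qed (fact continuous_coset_star continuous_coset_mult open_map_source)+
qed

lemma coset_map_open_slice: "coset_map N Z a \<in> open_slices coset_gpd"
proof -
  have "coset_map N Z a \<subseteq> cosets N Z" by (auto simp: coset_map_iff)
  moreover have "inj_on (src coset_gpd) (coset_map N Z a)" "inj_on (rng coset_gpd) (coset_map N Z a)"
    unfolding coset_groupoid_simps
    by (meson coset_eqI_source coset_eqI_range coset_map_iff inj_onI)+
  ultimately show ?thesis
    using openin_coset_map unfolding open_slices_def is_slice_def by simp
qed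

lemma coset_map_mult:
  assumes "symmetric_set Z"
  shows "coset_map N Z (a * b) = slice_mult coset_gpd (coset_map N Z a) (coset_map N Z b)"
proof
  show "coset_map N Z (a * b) \<subseteq> slice_mult coset_gpd (coset_map N Z a) (coset_map N Z b)"
  proof
    fix C assume "C \<in> coset_map N Z (a * b)"
    then obtain D E where "D \<in> cosets N Z" "E \<in> cosets N Z" "a \<in> D" "b \<in> E"
      "source D = range_unit E" "C = up (D * E)"
      using mult_factor[OF assms] unfolding coset_map_iff by metis
    then show "C \<in> slice_mult coset_gpd (coset_map N Z a) (coset_map N Z b)"
      unfolding slice_mult_def mem_Collect_eq
      by (intro exI[of _ D] exI[of _ E]) (simp add: coset_map_iff)
  qed
  show "slice_mult coset_gpd (coset_map N Z a) (coset_map N Z b) \<subseteq> coset_map N Z (a * b)"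
  proof
    fix C assume "C \<in> slice_mult coset_gpd (coset_map N Z a) (coset_map N Z b)"
    then obtain D E where C: "C = up (D * E)" "a \<in> D" "b \<in> E"
      "D \<in> cosets N Z" "E \<in> cosets N Z" "source D = range_unit E"
      by (auto simp: coset_map_iff slice_mult_def)
    then have "D * E \<subseteq> up (D * E)" by (intro rounded_mult coset_rounded)
    then show "C \<in> coset_map N Z (a * b)" using C mult_coset by (auto simp: coset_map_iff)
  qed
qed

lemma etale_representation_coset_map:
  assumes "symmetric_set Z"
  shows "etale_representation N Z coset_gpd (coset_map N Z)"
  unfolding etale_representation_def
proof (intro conjI allI ballI impI)
  fix n assume n: "n \<in> N"
  have "coset_map N Z n \<subseteq> gunits coset_gpd"
    using coset_meets_N[OF _ _ n] by (auto simp: coset_map_iff gunits_coset_groupoid)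
  then show "openin (subtopology (gtop coset_gpd) (gunits coset_gpd)) (coset_map N Z n)"
    by (metis openin_coset_map inf.absorb_iff2 openin_subtopology_Int2)
next
  fix C a assume C: "C \<in> arrows coset_gpd" "C \<in> coset_map N Z a"
  then show "\<exists>b. below N Z b a \<and> C \<in> coset_map N Z b"
    using coset_rounded by (fastforce simp: coset_map_iff up_iff)
qed (use assms in \<open>simp_all add: etale_groupoid_cosets coset_map_open_slice coset_map_mult Union_coset_map
      del: coset_groupoid_simps(2,4)\<close>)

end

section \<open>Units and inverses in groupoids\<close>

context groupoid
begin

lemma src_ginv: "g \<in> arrows G \<Longrightarrow> src G (ginv G g) = rng G g"
  by (simp add: src_def rng_def ginv_ginv)

lemma rng_ginv: "g \<in> arrows G \<Longrightarrow> rng G (ginv G g) = src G g"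
  by (simp add: src_def rng_def ginv_ginv)

lemma ginv_composable:
  assumes "g \<in> arrows G"
  shows "(ginv G g, g) \<in> composable G" "(g, ginv G g) \<in> composable G"
  using assms by (simp_all add: composable_def ginv_closed src_ginv rng_ginv)

lemma gunitsD:
  assumes "u \<in> gunits G"
  shows "u \<in> arrows G" "src G u = u" "rng G u = u"
proof -
  obtain g where g: "g \<in> arrows G" "u = src G g" using assms by (auto simp: gunits_def)
  then have u: "u = gmult G (ginv G g) g" by (simp add: src_def)
  note c = ginv_composable(1)[OF g(1)]
  show "u \<in> arrows G" "src G u = u" unfolding u using gmult_closed[OF c] src_gmult[OF c] g u by simp_all
  show "rng G u = u" unfolding u using rng_gmult[OF c] rng_ginv[OF g(1)] g u by simp
qed

lemma ginv_unique:
  assumes "(h, y) \<in> composable G" "gmult G h y = rng G h"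
  shows "y = ginv G h"
proof -
  have h: "h \<in> arrows G" "y \<in> arrows G" "src G h = rng G y" using assms by (auto simp: composable_def)
  have "y = gmult G (src G h) y" using rng_gmult_left h by simp
  also have "\<dots> = gmult G (ginv G h) (gmult G h y)"
    using gmult_assoc[OF ginv_composable(1)[OF h(1)] assms(1)] by (simp add: src_def)
  also have "\<dots> = gmult G (ginv G h) (src G (ginv G h))" using assms(2) src_ginv h by simp
  also have "\<dots> = ginv G h" using gmult_src ginv_closed h by simp
  finally show ?thesis .
qed

end

section \<open>Labels of arrows in a representation\<close>

locale structured_semigroup_representation = structured_semigroup N Z
  for N Z :: "'a::semigroup_mult set" +
  fixes H :: "('h, 'z) topological_groupoid_scheme" and \<theta> :: "'a \<Rightarrow> 'h set"
  assumes representation: "etale_representation N Z H \<theta>"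
begin

sublocale etale_groupoid H
  using representation by (simp add: etale_representation_def)

lemma open_slice: "\<theta> a \<in> open_slices H"
  using representation by (simp add: etale_representation_def)

lemma rep_arrows: "h \<in> \<theta> a \<Longrightarrow> h \<in> arrows H"
  using open_slice[of a] by (auto simp: open_slices_def is_slice_def)

lemma rep_mult: "\<theta> (a * b) = slice_mult H (\<theta> a) (\<theta> b)"
  using representation by (simp add: etale_representation_def)

lemma rep_multI:
  assumes "(h, i) \<in> composable H" "h \<in> \<theta> a" "i \<in> \<theta> b"
  shows "gmult H h i \<in> \<theta> (a * b)"
  using assms unfolding rep_mult slice_mult_def by blast

lemma rep_multE:
  assumes "g \<in> \<theta> (a * b)"
  obtains h i where "g = gmult H h i" "(h, i) \<in> composable H" "h \<in> \<theta> a" "i \<in> \<theta> b"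
  using assms unfolding rep_mult slice_mult_def by blast

lemma rep_eqI_rng: "h \<in> \<theta> a \<Longrightarrow> i \<in> \<theta> a \<Longrightarrow> rng H h = rng H i \<Longrightarrow> h = i"
  using open_slice[of a] by (auto simp: open_slices_def is_slice_def inj_on_def)

lemma rep_N:
  assumes "n \<in> N" "g \<in> \<theta> n"
  shows "g \<in> gunits H"
proof -
  have "openin (subtopology (gtop H) (gunits H)) (\<theta> n)"
    using representation assms(1) by (simp add: etale_representation_def)
  then show ?thesis using openin_subset assms(2) by fastforce
qed

lemma rep_rounded:
  assumes "h \<in> \<theta> a"
  obtains b s where "b \<sqsubset>[s] a" "h \<in> \<theta> b"
  using representation rep_arrows[OF assms] assms unfolding etale_representation_def below_def by metis

text \<open>
  Factor \<open>h\<close> according to \<open>a = (a * s) * b\<close>. The first factor is a unit, because \<open>a * s \<in> N\<close>, so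
  the second one is \<open>h\<close> itself. Factoring this unit according to \<open>a * s\<close>, its first factor is in the
  slice \<open>\<theta> a\<close> and has the range of \<open>h\<close>, hence is \<open>h\<close>; so the second factor is the inverse of \<open>h\<close>.
\<close>

lemma rep_below_via:
  assumes h: "h \<in> \<theta> a" and ab: "a \<sqsubset>[s] b"
  shows "ginv H h \<in> \<theta> s" "h \<in> \<theta> b"
proof -
  have "h \<in> \<theta> (a * s * b)" using h below_viaD(1)[OF ab] by simp
  then obtain g z where gz: "h = gmult H g z" "(g, z) \<in> composable H" "g \<in> \<theta> (a * s)" "z \<in> \<theta> b"
    by (rule rep_multE)
  note g = gunitsD[OF rep_N[OF below_viaD(3)[OF ab] gz(3)]]
  have gz': "g = rng H z" using gz(2) g by (simp add: composable_def)
  then have hz: "h = z" using gz(1) rng_gmult_left rep_arrows[OF gz(4)] by simp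
  then show "h \<in> \<theta> b" using gz(4) by simp
  obtain x y where xy: "g = gmult H x y" "(x, y) \<in> composable H" "x \<in> \<theta> a" "y \<in> \<theta> s"
    using gz(3) by (rule rep_multE)
  have "rng H h = rng H x" using rng_gmult[OF xy(2)] xy(1) g gz' hz by simp
  then have "x = h" using rep_eqI_rng xy h by metis
  then show "ginv H h \<in> \<theta> s" using ginv_unique[of h y] xy gz' hz by simp
qed

definition labels :: "'h \<Rightarrow> 'a set" where
  "labels h = {a. h \<in> \<theta> a}"

lemma labels_iff: "a \<in> labels h \<longleftrightarrow> h \<in> \<theta> a"
  by (simp add: labels_def)

text \<open>
  For the nontrivial inclusion, a label \<open>r \<sqsubset>[u] s\<close> of the inverse makes \<open>u\<close> a label of \<open>h\<close>, hence
  also \<open>u * r * u\<close>, which has \<open>s\<close> as an inverse.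
\<close>

lemma labels_ginv:
  assumes h: "h \<in> arrows H"
  shows "labels (ginv H h) = (labels h)\<^sup>\<star>"
proof
  show "(labels h)\<^sup>\<star> \<subseteq> labels (ginv H h)"
    using rep_below_via(1) by (auto simp: labels_iff star_iff)
  show "labels (ginv H h) \<subseteq> (labels h)\<^sup>\<star>"
  proof
    fix s assume "s \<in> labels (ginv H h)"
    then have s: "ginv H h \<in> \<theta> s" by (simp add: labels_iff)
    obtain r u where r: "r \<sqsubset>[u] s" "ginv H h \<in> \<theta> r" using rep_rounded[OF s] .
    have hu: "h \<in> \<theta> u" using rep_below_via(1)[OF r(2,1)] ginv_ginv[OF h] by simp
    have "rng H h \<in> \<theta> (u * r)"
      using rep_multI[OF ginv_composable(2)[OF h] hu r(2)] by (simp add: rng_def)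
    moreover have "(rng H h, h) \<in> composable H"
      using ginv_composable(2)[OF h] gmult_closed src_gmult src_ginv h
      by (simp add: composable_def rng_def)
    ultimately have "h \<in> \<theta> (u * r * u)"
      using rep_multI[of "rng H h" h "u * r" u] hu rng_gmult_left[OF h] by simp
    then show "s \<in> (labels h)\<^sup>\<star>"
      using below_via_dual[OF r(1)] starI labels_iff by blast
  qed
qed

lemma up_labels: "up (labels h) = labels h"
proof
  show "up (labels h) \<subseteq> labels h"
    using rep_below_via(2) by (auto simp: up_iff below_def labels_iff)
  show "labels h \<subseteq> up (labels h)"
  proof
    fix a assume "a \<in> labels h"
    then obtain b s where "b \<sqsubset>[s] a" "h \<in> \<theta> b" using rep_rounded labels_iff by metis
    then show "a \<in> up (labels h)" using upI labels_iff below_via_below by metis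
  qed
qed

lemma labels_coset:
  assumes h: "h \<in> arrows H"
  shows "labels h \<in> cosets N Z"
proof (rule cosetI)
  show "up (labels h) = labels h" by (rule up_labels)
  have "h \<in> (\<Union>a. \<theta> a)" using h representation by (simp add: etale_representation_def)
  then show "labels h \<noteq> {}" by (auto simp: labels_def)
  show "labels h * (labels h)\<^sup>\<star> * labels h \<subseteq> labels h"
  proof
    fix x assume "x \<in> labels h * (labels h)\<^sup>\<star> * labels h"
    then obtain a s b where x: "x = a * s * b" "h \<in> \<theta> a" "ginv H h \<in> \<theta> s" "h \<in> \<theta> b"
      unfolding labels_ginv[OF h, symmetric] by (metis labels_iff set_times_elim)
    have "rng H h \<in> \<theta> (a * s)"
      using rep_multI[OF ginv_composable(2)[OF h] x(2,3)] by (simp add: rng_def)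
    moreover have "(rng H h, h) \<in> composable H"
      using ginv_composable(2)[OF h] gmult_closed src_gmult src_ginv h
      by (simp add: composable_def rng_def)
    ultimately show "x \<in> labels h"
      using rep_multI[of "rng H h" h "a * s" b] x rng_gmult_left[OF h] by (simp add: labels_iff)
  qed
qed

text \<open>
  If \<open>c0 \<sqsubset> c\<close> labels \<open>h i\<close> and \<open>a0 \<sqsubset>[s] a\<close> labels \<open>h\<close>, then \<open>s * c0\<close> labels \<open>i\<close>, and
  \<open>a * (s * c0)\<close> is below \<open>c\<close> because \<open>a * s \<in> Z\<close> only shrinks \<open>c0\<close>.
\<close>

lemma labels_gmult:
  assumes hi: "(h, i) \<in> composable H"
  shows "labels (gmult H h i) = up (labels h * labels i)"
proof
  have m: "h \<in> arrows H" "i \<in> arrows H" "src H h = rng H i" using hi by (auto simp: composable_def)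
  have "labels h * labels i \<subseteq> labels (gmult H h i)"
    using rep_multI[OF hi] by (auto simp: labels_iff elim!: set_times_elim)
  then show "up (labels h * labels i) \<subseteq> labels (gmult H h i)" using up_mono up_labels by metis
  show "labels (gmult H h i) \<subseteq> up (labels h * labels i)"
  proof
    fix c assume "c \<in> labels (gmult H h i)"
    then obtain c0 v where c0: "c0 \<sqsubset>[v] c" "gmult H h i \<in> \<theta> c0" using rep_rounded labels_iff by metis
    obtain a where "h \<in> \<theta> a" using coset_nonempty[OF labels_coset[OF m(1)]] by (auto simp: labels_iff)
    then obtain a0 s where a0: "a0 \<sqsubset>[s] a" "h \<in> \<theta> a0" by (rule rep_rounded)
    have s: "ginv H h \<in> \<theta> s" "h \<in> \<theta> a" using rep_below_via[OF a0(2,1)] by simp_all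
    have "(ginv H h, gmult H h i) \<in> composable H"
      using hi m ginv_closed gmult_closed rng_gmult src_ginv by (simp add: composable_def)
    from rep_multI[OF this s(1) c0(2)] have "gmult H (ginv H h) (gmult H h i) \<in> \<theta> (s * c0)" .
    moreover have "gmult H (ginv H h) (gmult H h i) = i"
      using gmult_assoc[OF ginv_composable(1)[OF m(1)] hi] rng_gmult_left[OF m(2)] m(3) by (simp add: src_def)
    ultimately have "a * (s * c0) \<in> labels h * labels i" using s(2) by (auto simp: labels_iff)
    moreover have "a * (s * c0) \<sqsubset> c"
      using N_mult_below_via[OF Z_in_N[OF below_viaD(5)[OF a0(1)]] c0(1)] below_via_below
      by (simp add: mult.assoc)
    ultimately show "c \<in> up (labels h * labels i)" by (rule upI)
  qed
qed

lemma labels_src: "h \<in> arrows H \<Longrightarrow> labels (src H h) = source (labels h)"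
  using labels_gmult[OF ginv_composable(1)] labels_ginv by (simp add: src_def)

lemma labels_rng: "h \<in> arrows H \<Longrightarrow> labels (rng H h) = range_unit (labels h)"
  using labels_gmult[OF ginv_composable(2)] labels_ginv by (simp add: rng_def)

text \<open>
  For \<open>e \<sqsubset>[s] a\<close> in \<open>C\<close>, the element \<open>e * s\<close> of the range of \<open>C\<close> labels \<open>h\<close>, so
  \<open>h\<close> factors through an arrow of the slice \<open>\<theta> e\<close> with range \<open>h\<close>. This arrow and \<open>C\<close> share the
  label \<open>e\<close> and the range, so its label set is \<open>C\<close>; being in a slice, it is the only one.
\<close>

lemma labels_lift:
  assumes h: "h \<in> gunits H" and C: "C \<in> cosets N Z" "range_unit C = labels h"
  shows "\<exists>!i. i \<in> arrows H \<and> rng H i = h \<and> labels i = C"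
proof -
  note u = gunitsD[OF h]
  obtain a where a: "a \<in> C" using coset_nonempty[OF C(1)] by blast
  obtain e s where e: "e \<in> C" "e \<sqsubset>[s] a" "s \<in> C\<^sup>\<star>" using rounded_obtain[OF coset_rounded[OF C(1)] a] .
  have "h \<in> \<theta> (e * s)" using mult_star_in_range[OF C(1) e(1,3)] C(2) labels_iff by simp
  then obtain i y where i: "h = gmult H i y" "(i, y) \<in> composable H" "i \<in> \<theta> e" by (rule rep_multE)
  have i': "i \<in> arrows H" "rng H i = h" using rep_arrows[OF i(3)] rng_gmult[OF i(2)] i(1) u by simp_all
  show ?thesis
  proof (rule ex1I)
    have "labels i = C"
      using coset_eqI_range[OF labels_coset[OF i'(1)] C(1) _ e(1)] labels_rng[OF i'(1)] i'(2) i(3) C(2)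
      by (simp add: labels_iff)
    then show "i \<in> arrows H \<and> rng H i = h \<and> labels i = C" using i' by simp
    fix k assume k: "k \<in> arrows H \<and> rng H k = h \<and> labels k = C"
    then have "k \<in> \<theta> e" using e(1) labels_iff by metis
    then show "k = i" using rep_eqI_rng i(3) k i'(2) by metis
  qed
qed

lemma etale_morphism_labels: "etale_morphism H coset_gpd labels"
  unfolding etale_morphism_def
proof (intro conjI)
  show "continuous_map (gtop H) (gtop coset_gpd) labels"
  proof (rule continuous_map_into_cosets)
    show "labels h \<in> cosets N Z" if "h \<in> topspace (gtop H)" for h
      using that labels_coset topspace_gtop by simp
    fix a
    have "{h \<in> topspace (gtop H). a \<in> labels h} = \<theta> a"
      using rep_arrows topspace_gtop by (auto simp: labels_iff)
    then show "openin (gtop H) {h \<in> topspace (gtop H). a \<in> labels h}"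
      using open_slice[of a] by (simp add: open_slices_def)
  qed
  show "groupoid_functor H coset_gpd labels"
    unfolding groupoid_functor_def
    using labels_coset labels_src labels_rng labels_gmult by auto
  show "star_bijective H coset_gpd labels"
    unfolding star_bijective_def using labels_lift by simp
qed (simp_all add: etale_groupoid_axioms etale_groupoid_cosets del: coset_groupoid_simps)

lemma pullback_labels: "\<theta> = pullback H labels \<circ> coset_map N Z"
  using rep_arrows labels_coset by (auto simp: fun_eq_iff pullback_def coset_map_iff labels_iff)

lemma labels_unique:
  assumes "etale_morphism H coset_gpd \<psi>" "\<theta> = pullback H \<psi> \<circ> coset_map N Z" "h \<in> arrows H"
  shows "\<psi> h = labels h"
proof -
  have "\<psi> h \<in> cosets N Z"
    using assms(1,3) by (simp add: etale_morphism_def groupoid_functor_def)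
  moreover have "h \<in> \<theta> a \<longleftrightarrow> \<psi> h \<in> coset_map N Z a" for a
    using assms(3) by (subst assms(2)) (simp add: pullback_def)
  ultimately show ?thesis
    unfolding coset_map_iff labels_def by simp
qed

end

theorem theorem7p11:
  fixes N Z :: "'a::semigroup_mult set"
  assumes "structured_semigroup N Z"
    and "symmetric_set Z"
  shows "universal_etale_representation TYPE('h) N Z (coset_groupoid N Z) (coset_map N Z)"
  unfolding universal_etale_representation_def
proof (intro conjI allI impI)
  interpret structured_semigroup N Z by (rule assms(1))
  show "etale_representation N Z (coset_groupoid N Z) (coset_map N Z)"
    using assms(2) by (rule etale_representation_coset_map)
  fix H :: "'h topological_groupoid" and \<theta>
  assume "etale_representation N Z H \<theta>"
  then interpret R: structured_semigroup_representation N Z H \<theta>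
    by unfold_locales
  show "\<exists>\<phi>. etale_morphism H (coset_groupoid N Z) \<phi> \<and> \<theta> = pullback H \<phi> \<circ> coset_map N Z \<and>
    (\<forall>\<psi>. etale_morphism H (coset_groupoid N Z) \<psi> \<and> \<theta> = pullback H \<psi> \<circ> coset_map N Z \<longrightarrow>
      (\<forall>h\<in>arrows H. \<psi> h = \<phi> h))"
    using R.etale_morphism_labels R.pullback_labels R.labels_unique by blast
qed

end
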